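(* Let $\Phi$ be a CHC problem, i.e., a set of linear constrained Horn clauses over $\Sigma$ and $\mathcal{A}$, and let $\leadsto$ be the transition relation of the ADCL calculus. If $\Phi \leadsto^* \mathsf{sat}$, then $\Phi$ is satisfiable. If $\Phi \leadsto^* \mathsf{unsat}$, then $\Phi$ is unsatisfiable.
   Context: **Clauses.** $\Sigma$ is a many-sorted first-order signature containing only predicate symbols; $\mathcal{A}$ is a complete theory with equality over a many-sorted signature $\Sigma_{\mathcal{A}}$ disjoint from $\Sigma$; $\mathcal{V}$ is a countably infinite set of variables; $\mathsf{QF}(\mathcal{A})$ is the set of quantifier-free first-order formulas over $\Sigma_{\mathcal{A}}$. A (linear) CHC is a universally closed formula of one of the forms $\psi \Rightarrow G(\vec Y)$ (fact), $F(\vec X)\wedge\psi\Rightarrow G(\vec Y)$ (rule), $F(\vec X)\wedge \psi\Rightarrow\bot$ (query), $\psi\Rightarrow\bot$ (conditional empty clause), where $F,G\in\Sigma$, $\vec X,\vec Y$ are disjoint vectors of pairwise different variables, and $\psi\in\mathsf{QF}(\mathcal{A})$ is in negation normal form and may contain further variables. We uniformly write $\eta\wedge\psi\Rightarrow\eta'$, where $\eta$ can be $\top$ (no body atom) and $\eta'$ can be $\bot$ (no head atom). The condition is $\mathsf{cond}(\eta\wedge\psi\Rightarrow\eta')=\psi$; $\varphi|_{\psi'}$ is $\varphi$ with its condition replaced by $\psi'$. A CHC is recursive if it is a rule with $F=G$, and conjunctive if $\psi$ is a conjunction of literals. A CHC problem is a set of CHCs. **Semantics.** An $\mathcal{A}$-interpretation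 is a model of $\mathcal{A}$ whose carrier only contains ground terms over $\Sigma_{\mathcal{A}}$, extended with interpretations for $\Sigma$ and $\mathcal{V}$; as $\mathcal{A}$ is complete, $\mathcal{A}$-interpretations are regarded as differing only on $\Sigma$ and $\mathcal{V}$. $\sigma\models_{\mathcal{A}}\eta$ means that the $\mathcal{A}$-interpretation $\sigma$ satisfies $\eta$; a formula (or set of formulas) is satisfiable if some $\mathcal{A}$-interpretation satisfies it (all of its elements). The ground instances are $\mathsf{grnd}(\eta\wedge\psi\Rightarrow\eta')=\{\eta\sigma\Rightarrow\eta'\sigma\mid\sigma\models_{\mathcal{A}}\psi\}$, where $\eta\sigma$ instantiates the variables of $\eta$ according to $\sigma$. **Resolution.** For $\varphi=(\eta\wedge\psi\Rightarrow F(\vec x))$ and $\varphi'=(F(\vec y)\wedge\psi'\Rightarrow\eta')$, renamed to be variable-disjoint, with $\theta=\mathrm{mgu}(F(\vec x),F(\vec y))$, let $\mathsf{res}(\varphi,\varphi')=(\eta\wedge\psi\wedge\psi'\Rightarrow\eta')\theta$; in all other cases $\mathsf{res}(\varphi,\varphi')=(\bot\Rightarrow\bot)$. For non-empty sequences: $\mathsf{res}([\varphi_1])=\varphi_1$, $\mathsf{res}([\varphi_1,\varphi_2]::\vec\varphi)=\mathsf{res}(\mathsf{res}(\varphi_1,\varphi_2)::\vec\varphi)$, where $::$ is concatenation (single elements are identified with sequences of length 1). Notions for CHCs are lifted to sequences via $\mathsf{res}$, e.g. $\mathsf{cond}(\vec\varphi)=\mathsf{cond}(\mathsf{res}(\vec\varphi))$,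 $\mathsf{grnd}(\vec\varphi)=\mathsf{grnd}(\mathsf{res}(\vec\varphi))$, and $\vec\varphi$ is recursive if $\mathsf{res}(\vec\varphi)$ is. A refutation is a conditional empty clause with satisfiable condition (lifted to sequences in the same way). **Acceleration.** An acceleration technique is a function $\mathsf{accel}$ mapping a recursive conjunctive CHC $\varphi$ to a recursive conjunctive CHC such that $\mathsf{grnd}(\mathsf{accel}(\varphi))=\bigcup_{n\ge1}\mathsf{grnd}(\varphi^n)$, where $\varphi^n$ is the sequence of $n$ copies of $\varphi$. $\mathsf{accel}(\vec\varphi)$ means $\mathsf{accel}(\mathsf{res}(\vec\varphi))$. One assumes oracles for acceleration, for checking redundancy (defined below), and for satisfiability of $\mathsf{QF}(\mathcal{A})$-formulas. The condition of an accelerated clause may not be expressible in $\mathcal{A}$; therefore, when the rule Accelerate below is applied, one may implicitly switch to a richer theory $\mathcal{A}'$ (e.g., from linear to non-linear arithmetic). **Syntactic implicants.** For $\psi\in\mathsf{QF}(\mathcal{A})$ in negation normal form and $\sigma\models_{\mathcal{A}}\psi$ let $\mathsf{sip}(\psi,\sigma)=\bigwedge\{\ell \text{ is a literal of }\psi\mid\sigma\models_{\mathcal{A}}\ell\}$; $\mathsf{sip}(\psi)=\{\mathsf{sip}(\psi,\sigma)\mid\sigma\models_{\mathcal{A}}\psi\}$; $\mathsf{sip}(\varphi)=\{\varphi|_\psi\mid\psi\in\mathsf{sip}(\mathsf{cond}(\varphi))\}$ for CHCs $\varphi$; $\mathsf{sip}(\Pi)=\bigcup_{\varphi\in\Pi}\mathsf{sip}(\varphi)$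 for sets of CHCs $\Pi$. **Redundancy.** $\varphi\sqsubseteq\pi$ iff $\mathsf{grnd}(\varphi)\subseteq\mathsf{grnd}(\pi)$; $\varphi\sqsubset\pi$ iff $\mathsf{grnd}(\varphi)\subsetneq\mathsf{grnd}(\pi)$; for a set $\Pi$ of CHCs, $\varphi\sqsubseteq\Pi$ (resp. $\varphi\sqsubset\Pi$) iff $\varphi\sqsubseteq\pi$ (resp. $\varphi\sqsubset\pi$) for some $\pi\in\Pi$. **ADCL.** $\Phi$ is the original CHC problem. A state is a triple $(\Pi,[\varphi_i]_{i=1}^k,[B_i]_{i=0}^k)$ with $\Pi\supseteq\Phi$ a CHC problem, $[\varphi_i]_{i=1}^k\in\mathsf{sip}(\Pi)^*$ (the trace), and $B_i\subseteq\mathsf{sip}(\Pi)$ for each $0\le i\le k$. A clause $\varphi$ is blocked if $\varphi\sqsubseteq B_k$, and active if it is not blocked and $\mathsf{cond}([\varphi_i]_{i=1}^k::\varphi)$ is satisfiable; otherwise it is inactive. Let $\mathsf{bt}(\Pi,[\varphi_i]_{i=1}^k,[B_0,\dots,B_k])=(\Pi,[\varphi_i]_{i=1}^{k-1},[B_0,\dots,B_{k-1}\cup\{\varphi_k\}])$. The relation $\leadsto$ is given by the following rules: - Init: $\Phi\leadsto(\Phi,[],[\emptyset])$. - Step: $(\Pi,\vec\varphi,\vec B)\leadsto(\Pi,\vec\varphi::\varphi,\vec B::\emptyset)$ if $\varphi\in\mathsf{sip}(\Pi)$ is active. - Accelerate: $(\Pi,\vec\varphi::\vec\varphi^\circ,\vec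 B::\vec B^\circ)\leadsto(\Pi\cup\{\varphi\},\vec\varphi::\varphi,\vec B::\{\varphi\})$ if $\vec\varphi^\circ$ is recursive, $|\vec\varphi^\circ|=|\vec B^\circ|$, and $\mathsf{accel}(\vec\varphi^\circ)=\varphi$. - Covered: $s=(\Pi,\vec\varphi::\vec\varphi',\vec B)\leadsto\mathsf{bt}(s)$ if $\vec\varphi'\sqsubset\mathsf{sip}(\Pi)$, or $\vec\varphi'\sqsubseteq\mathsf{sip}(\Pi)$ and $|\vec\varphi'|>1$. - Backtrack: $s=(\Pi,\vec\varphi::\varphi,\vec B)\leadsto\mathsf{bt}(s)$ if all rules and queries from $\mathsf{sip}(\Pi)$ are inactive and $\varphi$ is not a query. - Refute: $(\Pi,\vec\varphi,\vec B)\leadsto\mathsf{unsat}$ if $\vec\varphi$ is a refutation. - Prove: $(\Pi,[],[B])\leadsto\mathsf{sat}$ if all facts and conditional empty clauses from $\mathsf{sip}(\Pi)$ are inactive. $\leadsto^*$ is the reflexive-transitive closure of $\leadsto$.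
   Formalization: The rule Backtrack is additionally required not to apply when φ is a conditional empty clause; as stated, Φ = {⊤ ⇒ ⊥} would reach sat by Init, Step, Backtrack, Prove although it is unsatisfiable. *)

theory Defs
  imports Main "HOL-Library.Countable"
begin

section \<open>Many-sorted first-order logic\<close>

text \<open>
  Symbols carry their sorts.  There are countably many variables of each sort, so for a countable
  type of sorts the set of all variables is countably infinite and renaming apart always succeeds.
\<close>

datatype 's var = V (vname: nat) (vsort: 's)
datatype ('f, 's) fsym = FSym (fname: 'f) (fdom: "'s list") (fcod: 's)
datatype ('p, 's) psym = PSym (pname: 'p) (pdom: "'s list")

datatype (funs_trm: 'f, vars_trm: 'v) trm = Var 'v | Fun 'f "('f, 'v) trm list"

type_synonym ('f, 's) strm = "(('f, 's) fsym, 's var) trm"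

inductive has_sort :: "('f, 's) strm \<Rightarrow> 's \<Rightarrow> bool" where
  "has_sort (Var x) (vsort x)"
| "list_all2 has_sort ts (fdom f) \<Longrightarrow> has_sort (Fun f ts) (fcod f)"

datatype ('f, 'q, 's) fm =
    Top
  | Bot
  | Eq "('f, 's) strm" "('f, 's) strm"
  | Pred "('q, 's) psym" "('f, 's) strm list"
  | Neg "('f, 'q, 's) fm"
  | And "('f, 'q, 's) fm" "('f, 'q, 's) fm"
  | Or "('f, 'q, 's) fm" "('f, 'q, 's) fm"
  | All "'s var" "('f, 'q, 's) fm"
  | Ex "'s var" "('f, 'q, 's) fm"

fun vars_fm :: "('f, 'q, 's) fm \<Rightarrow> 's var set" where
  "vars_fm Top = {}"
| "vars_fm Bot = {}"
| "vars_fm (Eq s t) = vars_trm s \<union> vars_trm t"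
| "vars_fm (Pred q ts) = (\<Union>t\<in>set ts. vars_trm t)"
| "vars_fm (Neg \<psi>) = vars_fm \<psi>"
| "vars_fm (And \<psi> \<psi>') = vars_fm \<psi> \<union> vars_fm \<psi>'"
| "vars_fm (Or \<psi> \<psi>') = vars_fm \<psi> \<union> vars_fm \<psi>'"
| "vars_fm (All x \<psi>) = vars_fm \<psi> - {x}"
| "vars_fm (Ex x \<psi>) = vars_fm \<psi> - {x}"

fun quantifier_free :: "('f, 'q, 's) fm \<Rightarrow> bool" where
  "quantifier_free (Neg \<psi>) \<longleftrightarrow> quantifier_free \<psi>"
| "quantifier_free (And \<psi> \<psi>') \<longleftrightarrow> quantifier_free \<psi> \<and> quantifier_free \<psi>'"
| "quantifier_free (Or \<psi> \<psi>') \<longleftrightarrow> quantifier_free \<psi> \<and> quantifier_free \<psi>'"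
| "quantifier_free (All x \<psi>) \<longleftrightarrow> False"
| "quantifier_free (Ex x \<psi>) \<longleftrightarrow> False"
| "quantifier_free _ \<longleftrightarrow> True"

fun atomic :: "('f, 'q, 's) fm \<Rightarrow> bool" where
  "atomic (Eq s t) \<longleftrightarrow> True"
| "atomic (Pred q ts) \<longleftrightarrow> True"
| "atomic _ \<longleftrightarrow> False"

fun literal :: "('f, 'q, 's) fm \<Rightarrow> bool" where
  "literal (Neg \<psi>) \<longleftrightarrow> atomic \<psi>"
| "literal \<psi> \<longleftrightarrow> atomic \<psi>"

fun nnf :: "('f, 'q, 's) fm \<Rightarrow> bool" where
  "nnf (Neg \<psi>) \<longleftrightarrow> atomic \<psi>"
| "nnf (And \<psi> \<psi>') \<longleftrightarrow> nnf \<psi> \<and> nnf \<psi>'"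
| "nnf (Or \<psi> \<psi>') \<longleftrightarrow> nnf \<psi> \<and> nnf \<psi>'"
| "nnf (All x \<psi>) \<longleftrightarrow> nnf \<psi>"
| "nnf (Ex x \<psi>) \<longleftrightarrow> nnf \<psi>"
| "nnf _ \<longleftrightarrow> True"

text \<open>The literals of a quantifier-free formula in negation normal form.\<close>

fun lits :: "('f, 'q, 's) fm \<Rightarrow> ('f, 'q, 's) fm set" where
  "lits (And \<psi> \<psi>') = lits \<psi> \<union> lits \<psi>'"
| "lits (Or \<psi> \<psi>') = lits \<psi> \<union> lits \<psi>'"
| "lits \<psi> = (if literal \<psi> then {\<psi>} else {})"

text \<open>\<open>Top\<close> is the empty conjunction.\<close>

fun literal_conj :: "('f, 'q, 's) fm \<Rightarrow> bool" where
  "literal_conj Top \<longleftrightarrow> True"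
| "literal_conj (And \<psi> \<psi>') \<longleftrightarrow> literal_conj \<psi> \<and> literal_conj \<psi>'"
| "literal_conj \<psi> \<longleftrightarrow> literal \<psi>"


section \<open>Background theories\<close>

text \<open>
  A background theory consists of a signature, a set of sentences, and the one interpretation of
  the signature (with ground terms as elements) that all interpretations of the theory share:
  these are regarded as differing only on the uninterpreted predicates and the variables.
\<close>

record ('f, 'q, 's) background =
  sorts :: "'s set"
  funs :: "('f, 's) fsym set"
  preds :: "('q, 's) psym set"
  sentences :: "('f, 'q, 's) fm set"
  univ :: "'s \<Rightarrow> ('f, 's) strm set"
  fint :: "('f, 's) fsym \<Rightarrow> ('f, 's) strm list \<Rightarrow> ('f, 's) strm"
  pint :: "('q, 's) psym \<Rightarrow> ('f, 's) strm list \<Rightarrow> bool"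

definition signature :: "('f, 'q, 's) background \<Rightarrow> bool" where
  "signature T \<longleftrightarrow>
     (\<forall>f\<in>funs T. set (fdom f) \<subseteq> sorts T \<and> fcod f \<in> sorts T) \<and>
     (\<forall>q\<in>preds T. set (pdom q) \<subseteq> sorts T)"

definition term_over :: "('f, 'q, 's) background \<Rightarrow> ('f, 's) strm \<Rightarrow> 's \<Rightarrow> bool" where
  "term_over T t s \<longleftrightarrow>
     has_sort t s \<and> funs_trm t \<subseteq> funs T \<and> vsort ` vars_trm t \<subseteq> sorts T"

fun fm_over :: "('f, 'q, 's) background \<Rightarrow> ('f, 'q, 's) fm \<Rightarrow> bool" where
  "fm_over T Top \<longleftrightarrow> True"
| "fm_over T Bot \<longleftrightarrow> True"
| "fm_over T (Eq t t') \<longleftrightarrow> (\<exists>s. term_over T t s \<and> term_over T t' s)"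
| "fm_over T (Pred q ts) \<longleftrightarrow> q \<in> preds T \<and> list_all2 (term_over T) ts (pdom q)"
| "fm_over T (Neg \<psi>) \<longleftrightarrow> fm_over T \<psi>"
| "fm_over T (And \<psi> \<psi>') \<longleftrightarrow> fm_over T \<psi> \<and> fm_over T \<psi>'"
| "fm_over T (Or \<psi> \<psi>') \<longleftrightarrow> fm_over T \<psi> \<and> fm_over T \<psi>'"
| "fm_over T (All x \<psi>) \<longleftrightarrow> vsort x \<in> sorts T \<and> fm_over T \<psi>"
| "fm_over T (Ex x \<psi>) \<longleftrightarrow> vsort x \<in> sorts T \<and> fm_over T \<psi>"

definition sentence_over :: "('f, 'q, 's) background \<Rightarrow> ('f, 'q, 's) fm \<Rightarrow> bool" where
  "sentence_over T \<psi> \<longleftrightarrow> fm_over T \<psi> \<and> vars_fm \<psi> = {}"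

type_synonym ('f, 's) subst = "'s var \<Rightarrow> ('f, 's) strm"

fun eval :: "('f, 'q, 's) background \<Rightarrow> ('f, 's) subst \<Rightarrow> ('f, 's) strm \<Rightarrow> ('f, 's) strm" where
  "eval T \<sigma> (Var x) = \<sigma> x"
| "eval T \<sigma> (Fun f ts) = fint T f (map (eval T \<sigma>) ts)"

fun sat :: "('f, 'q, 's) background \<Rightarrow> ('f, 's) subst \<Rightarrow> ('f, 'q, 's) fm \<Rightarrow> bool" where
  "sat T \<sigma> Top \<longleftrightarrow> True"
| "sat T \<sigma> Bot \<longleftrightarrow> False"
| "sat T \<sigma> (Eq s t) \<longleftrightarrow> eval T \<sigma> s = eval T \<sigma> t"
| "sat T \<sigma> (Pred q ts) \<longleftrightarrow> pint T q (map (eval T \<sigma>) ts)"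
| "sat T \<sigma> (Neg \<psi>) \<longleftrightarrow> \<not> sat T \<sigma> \<psi>"
| "sat T \<sigma> (And \<psi> \<psi>') \<longleftrightarrow> sat T \<sigma> \<psi> \<and> sat T \<sigma> \<psi>'"
| "sat T \<sigma> (Or \<psi> \<psi>') \<longleftrightarrow> sat T \<sigma> \<psi> \<or> sat T \<sigma> \<psi>'"
| "sat T \<sigma> (All x \<psi>) \<longleftrightarrow> (\<forall>a\<in>univ T (vsort x). sat T (\<sigma>(x := a)) \<psi>)"
| "sat T \<sigma> (Ex x \<psi>) \<longleftrightarrow> (\<exists>a\<in>univ T (vsort x). sat T (\<sigma>(x := a)) \<psi>)"

text \<open>
  Elements of the carriers are ground terms, so an interpretation of the variables is also a
  substitution.
\<close>

definition valuation :: "('f, 'q, 's) background \<Rightarrow> ('f, 's) subst \<Rightarrow> bool" where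
  "valuation T \<sigma> \<longleftrightarrow> (\<forall>x. vsort x \<in> sorts T \<longrightarrow> \<sigma> x \<in> univ T (vsort x))"

definition satisfiable_fm :: "('f, 'q, 's) background \<Rightarrow> ('f, 'q, 's) fm \<Rightarrow> bool" where
  "satisfiable_fm T \<psi> \<longleftrightarrow> (\<exists>\<sigma>. valuation T \<sigma> \<and> sat T \<sigma> \<psi>)"

definition ground_term_structure :: "('f, 'q, 's) background \<Rightarrow> bool" where
  "ground_term_structure T \<longleftrightarrow>
     (\<forall>s\<in>sorts T. univ T s \<noteq> {} \<and> univ T s \<subseteq> {t. term_over T t s \<and> vars_trm t = {}}) \<and>
     (\<forall>f\<in>funs T. \<forall>ts. list_all2 (\<lambda>t s. t \<in> univ T s) ts (fdom f)
        \<longrightarrow> fint T f ts \<in> univ T (fcod f))"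

text \<open>
  Theories are deductively closed sets of sentences; closure need not be required separately,
  since it follows from the last two conditions below.
\<close>

definition background_theory :: "('f, 'q, 's) background \<Rightarrow> bool" where
  "background_theory T \<longleftrightarrow>
     signature T \<and>
     ground_term_structure T \<and>
     (\<forall>\<psi>\<in>sentences T. sentence_over T \<psi>) \<and>
     (\<forall>\<psi>. sentence_over T \<psi> \<longrightarrow> \<psi> \<in> sentences T \<or> Neg \<psi> \<in> sentences T) \<and>
     (\<forall>\<psi>\<in>sentences T. \<forall>\<sigma>. valuation T \<sigma> \<longrightarrow> sat T \<sigma> \<psi>)"

text \<open>\<open>richer T T'\<close>: \<open>T'\<close> extends \<open>T\<close>, and its interpretation expands that of \<open>T\<close>.\<close>

definition richer :: "('f, 'q, 's) background \<Rightarrow> ('f, 'q, 's) background \<Rightarrow> bool" where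
  "richer T T' \<longleftrightarrow>
     sorts T \<subseteq> sorts T' \<and> funs T \<subseteq> funs T' \<and> preds T \<subseteq> preds T' \<and>
     sentences T \<subseteq> sentences T' \<and>
     (\<forall>s\<in>sorts T. univ T' s = univ T s) \<and>
     (\<forall>f\<in>funs T. \<forall>ts. list_all2 (\<lambda>t s. t \<in> univ T s) ts (fdom f)
        \<longrightarrow> fint T' f ts = fint T f ts) \<and>
     (\<forall>q\<in>preds T. \<forall>ts. list_all2 (\<lambda>t s. t \<in> univ T s) ts (pdom q)
        \<longrightarrow> pint T' q ts = pint T q ts)"


section \<open>Substitutions\<close>

fun subst_trm :: "('f, 's) subst \<Rightarrow> ('f, 's) strm \<Rightarrow> ('f, 's) strm" where
  "subst_trm \<theta> (Var x) = \<theta> x"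
| "subst_trm \<theta> (Fun f ts) = Fun f (map (subst_trm \<theta>) ts)"

text \<open>Not capture-avoiding; only applied to quantifier-free formulas below.\<close>

fun subst_fm :: "('f, 's) subst \<Rightarrow> ('f, 'q, 's) fm \<Rightarrow> ('f, 'q, 's) fm" where
  "subst_fm \<theta> Top = Top"
| "subst_fm \<theta> Bot = Bot"
| "subst_fm \<theta> (Eq s t) = Eq (subst_trm \<theta> s) (subst_trm \<theta> t)"
| "subst_fm \<theta> (Pred q ts) = Pred q (map (subst_trm \<theta>) ts)"
| "subst_fm \<theta> (Neg \<psi>) = Neg (subst_fm \<theta> \<psi>)"
| "subst_fm \<theta> (And \<psi> \<psi>') = And (subst_fm \<theta> \<psi>) (subst_fm \<theta> \<psi>')"
| "subst_fm \<theta> (Or \<psi> \<psi>') = Or (subst_fm \<theta> \<psi>) (subst_fm \<theta> \<psi>')"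
| "subst_fm \<theta> (All x \<psi>) = All x (subst_fm (\<theta>(x := Var x)) \<psi>)"
| "subst_fm \<theta> (Ex x \<psi>) = Ex x (subst_fm (\<theta>(x := Var x)) \<psi>)"

definition sorted_subst :: "('f, 's) subst \<Rightarrow> bool" where
  "sorted_subst \<theta> \<longleftrightarrow> (\<forall>x. has_sort (\<theta> x) (vsort x))"

definition renaming :: "('s var \<Rightarrow> 's var) \<Rightarrow> bool" where
  "renaming \<rho> \<longleftrightarrow> bij \<rho> \<and> (\<forall>x. vsort (\<rho> x) = vsort x)"


section \<open>Linear constrained Horn clauses\<close>

datatype ('p, 'f, 's) atom = Atom (pred: "('p, 's) psym") (args: "('f, 's) strm list")

text \<open>A missing body atom stands for \<open>\<top>\<close>, a missing head atom for \<open>\<bottom>\<close>.\<close>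

datatype ('p, 'f, 'q, 's) chc =
  CHC (body: "('p, 'f, 's) atom option") (cond: "('f, 'q, 's) fm")
    (head: "('p, 'f, 's) atom option")

fun flat :: "('p, 's) psym set \<Rightarrow> ('f, 'q, 's) background \<Rightarrow>
    ('p, 'f, 's) atom option \<Rightarrow> 's var list \<Rightarrow> bool" where
  "flat \<Sigma> T None X \<longleftrightarrow> X = []"
| "flat \<Sigma> T (Some (Atom F ts)) X \<longleftrightarrow>
     F \<in> \<Sigma> \<and> ts = map Var X \<and> map vsort X = pdom F \<and> set (pdom F) \<subseteq> sorts T"

definition is_chc ::
  "('p, 's) psym set \<Rightarrow> ('f, 'q, 's) background \<Rightarrow> ('p, 'f, 'q, 's) chc \<Rightarrow> bool" where
  "is_chc \<Sigma> T \<phi> \<longleftrightarrow>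
     (\<exists>X Y. flat \<Sigma> T (body \<phi>) X \<and> flat \<Sigma> T (head \<phi>) Y \<and> distinct (X @ Y)) \<and>
     fm_over T (cond \<phi>) \<and> quantifier_free (cond \<phi>) \<and> nnf (cond \<phi>)"

definition is_fact :: "('p, 'f, 'q, 's) chc \<Rightarrow> bool" where
  "is_fact \<phi> \<longleftrightarrow> body \<phi> = None \<and> head \<phi> \<noteq> None"

definition is_rule :: "('p, 'f, 'q, 's) chc \<Rightarrow> bool" where
  "is_rule \<phi> \<longleftrightarrow> body \<phi> \<noteq> None \<and> head \<phi> \<noteq> None"

definition is_query :: "('p, 'f, 'q, 's) chc \<Rightarrow> bool" where
  "is_query \<phi> \<longleftrightarrow> body \<phi> \<noteq> None \<and> head \<phi> = None"

definition is_conditional_empty :: "('p, 'f, 'q, 's) chc \<Rightarrow> bool" where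
  "is_conditional_empty \<phi> \<longleftrightarrow> body \<phi> = None \<and> head \<phi> = None"

definition recursive :: "('p, 'f, 'q, 's) chc \<Rightarrow> bool" where
  "recursive \<phi> \<longleftrightarrow> is_rule \<phi> \<and> pred (the (body \<phi>)) = pred (the (head \<phi>))"

definition conjunctive :: "('p, 'f, 'q, 's) chc \<Rightarrow> bool" where
  "conjunctive \<phi> \<longleftrightarrow> literal_conj (cond \<phi>)"

definition with_cond ::
  "('p, 'f, 'q, 's) chc \<Rightarrow> ('f, 'q, 's) fm \<Rightarrow> ('p, 'f, 'q, 's) chc" where
  "with_cond \<phi> \<psi> = CHC (body \<phi>) \<psi> (head \<phi>)"

text \<open>
  An interpretation of the uninterpreted predicates; its values outside the carriers of the
  background theory are never consulted.
\<close>

type_synonym ('p, 'f, 's) interp = "('p, 's) psym \<Rightarrow> ('f, 's) strm list \<Rightarrow> bool"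

definition sat_atom :: "('f, 'q, 's) background \<Rightarrow> ('p, 'f, 's) interp \<Rightarrow> ('f, 's) subst \<Rightarrow>
    ('p, 'f, 's) atom \<Rightarrow> bool" where
  "sat_atom T I \<sigma> a \<longleftrightarrow> I (pred a) (map (eval T \<sigma>) (args a))"

definition sat_chc :: "('f, 'q, 's) background \<Rightarrow> ('p, 'f, 's) interp \<Rightarrow>
    ('p, 'f, 'q, 's) chc \<Rightarrow> bool" where
  "sat_chc T I \<phi> \<longleftrightarrow>
     (\<forall>\<sigma>. valuation T \<sigma> \<longrightarrow>
        (case body \<phi> of None \<Rightarrow> True | Some a \<Rightarrow> sat_atom T I \<sigma> a) \<and> sat T \<sigma> (cond \<phi>) \<longrightarrow>
        (case head \<phi> of None \<Rightarrow> False | Some a \<Rightarrow> sat_atom T I \<sigma> a))"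

definition satisfiable :: "('f, 'q, 's) background \<Rightarrow> ('p, 'f, 'q, 's) chc set \<Rightarrow> bool" where
  "satisfiable T \<Phi> \<longleftrightarrow> (\<exists>I. \<forall>\<phi>\<in>\<Phi>. sat_chc T I \<phi>)"

definition subst_atom :: "('f, 's) subst \<Rightarrow> ('p, 'f, 's) atom \<Rightarrow> ('p, 'f, 's) atom" where
  "subst_atom \<theta> a = Atom (pred a) (map (subst_trm \<theta>) (args a))"

definition subst_chc ::
  "('f, 's) subst \<Rightarrow> ('p, 'f, 'q, 's) chc \<Rightarrow> ('p, 'f, 'q, 's) chc" where
  "subst_chc \<theta> \<phi> = CHC (map_option (subst_atom \<theta>) (body \<phi>)) (subst_fm \<theta> (cond \<phi>))
     (map_option (subst_atom \<theta>) (head \<phi>))"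

definition vars_atom :: "('p, 'f, 's) atom \<Rightarrow> 's var set" where
  "vars_atom a = (\<Union>t\<in>set (args a). vars_trm t)"

definition vars_chc :: "('p, 'f, 'q, 's) chc \<Rightarrow> 's var set" where
  "vars_chc \<phi> = (\<Union>a\<in>set_option (body \<phi>). vars_atom a) \<union> vars_fm (cond \<phi>) \<union>
     (\<Union>a\<in>set_option (head \<phi>). vars_atom a)"

text \<open>A ground clause is represented by the pair of its body and its head.\<close>

definition grnd :: "('f, 'q, 's) background \<Rightarrow> ('p, 'f, 'q, 's) chc \<Rightarrow>
    (('p, 'f, 's) atom option \<times> ('p, 'f, 's) atom option) set" where
  "grnd T \<phi> = {(map_option (subst_atom \<sigma>) (body \<phi>), map_option (subst_atom \<sigma>) (head \<phi>)) | \<sigma>.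
     valuation T \<sigma> \<and> sat T \<sigma> (cond \<phi>)}"


section \<open>Resolution\<close>

definition is_mgu ::
  "('f, 's) subst \<Rightarrow> ('p, 'f, 's) atom \<Rightarrow> ('p, 'f, 's) atom \<Rightarrow> bool" where
  "is_mgu \<theta> a b \<longleftrightarrow>
     sorted_subst \<theta> \<and> subst_atom \<theta> a = subst_atom \<theta> b \<and>
     (\<forall>\<tau>. sorted_subst \<tau> \<and> subst_atom \<tau> a = subst_atom \<tau> b \<longrightarrow>
        (\<exists>\<delta>. sorted_subst \<delta> \<and> (\<forall>x. \<tau> x = subst_trm \<delta> (\<theta> x))))"

definition resolvent ::
  "('p, 'f, 'q, 's) chc \<Rightarrow> ('p, 'f, 'q, 's) chc \<Rightarrow> ('p, 'f, 'q, 's) chc \<Rightarrow> bool" where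
  "resolvent \<phi> \<phi>' \<chi> \<longleftrightarrow>
     (\<exists>\<rho> \<rho>' \<phi>\<^sub>1 \<phi>\<^sub>2 a b \<theta>.
        renaming \<rho> \<and> renaming \<rho>' \<and>
        \<phi>\<^sub>1 = subst_chc (Var \<circ> \<rho>) \<phi> \<and> \<phi>\<^sub>2 = subst_chc (Var \<circ> \<rho>') \<phi>' \<and>
        vars_chc \<phi>\<^sub>1 \<inter> vars_chc \<phi>\<^sub>2 = {} \<and>
        head \<phi>\<^sub>1 = Some a \<and> body \<phi>\<^sub>2 = Some b \<and> is_mgu \<theta> a b \<and>
        \<chi> = subst_chc \<theta> (CHC (body \<phi>\<^sub>1) (And (cond \<phi>\<^sub>1) (cond \<phi>\<^sub>2)) (head \<phi>\<^sub>2)))"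

text \<open>Resolvents are unique only up to variable renaming; \<open>res\<close> selects one of them.\<close>

definition res ::
  "('p, 'f, 'q, 's) chc \<Rightarrow> ('p, 'f, 'q, 's) chc \<Rightarrow> ('p, 'f, 'q, 's) chc" where
  "res \<phi> \<phi>' = (if \<exists>\<chi>. resolvent \<phi> \<phi>' \<chi> then SOME \<chi>. resolvent \<phi> \<phi>' \<chi> else CHC None Bot None)"

text \<open>Unspecified for the empty sequence.\<close>

fun res_seq :: "('p, 'f, 'q, 's) chc list \<Rightarrow> ('p, 'f, 'q, 's) chc" where
  "res_seq [\<phi>] = \<phi>"
| "res_seq (\<phi>\<^sub>1 # \<phi>\<^sub>2 # \<phi>s) = res_seq (res \<phi>\<^sub>1 \<phi>\<^sub>2 # \<phi>s)"

definition is_refutation :: "('f, 'q, 's) background \<Rightarrow> ('p, 'f, 'q, 's) chc \<Rightarrow> bool" where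
  "is_refutation T \<phi> \<longleftrightarrow> is_conditional_empty \<phi> \<and> satisfiable_fm T (cond \<phi>)"


section \<open>Acceleration\<close>

text \<open>
  The condition of the accelerated clause need not be expressible in the current theory \<open>T\<close>.
  Hence \<open>accel T\<close> also yields the (possibly) richer theory to be used from then on, where \<open>\<T>\<close> is
  the collection of all theories that may be used.
\<close>

definition acceleration_technique :: "('p, 's) psym set \<Rightarrow> ('f, 'q, 's) background set \<Rightarrow>
    (('f, 'q, 's) background \<Rightarrow> ('p, 'f, 'q, 's) chc \<Rightarrow>
      ('f, 'q, 's) background \<times> ('p, 'f, 'q, 's) chc) \<Rightarrow> bool" where
  "acceleration_technique \<Sigma> \<T> accel \<longleftrightarrow>
     (\<forall>T\<in>\<T>. \<forall>\<phi>. is_chc \<Sigma> T \<phi> \<and> recursive \<phi> \<and> conjunctive \<phi> \<longrightarrow>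
        (\<exists>T' \<phi>'. accel T \<phi> = (T', \<phi>') \<and> T' \<in> \<T> \<and> richer T T' \<and>
           is_chc \<Sigma> T' \<phi>' \<and> recursive \<phi>' \<and> conjunctive \<phi>' \<and>
           grnd T' \<phi>' = (\<Union>n\<in>{1..}. grnd T' (res_seq (replicate n \<phi>)))))"


section \<open>Syntactic implicants and redundancy\<close>

text \<open>
  The conjunction of a finite set of literals is syntactically determined only up to
  associativity, commutativity and idempotence, so \<open>sip_val T \<psi> \<sigma>\<close> is the set of all its
  representations.
\<close>

definition sip_val :: "('f, 'q, 's) background \<Rightarrow> ('f, 'q, 's) fm \<Rightarrow> ('f, 's) subst \<Rightarrow>
    ('f, 'q, 's) fm set" where
  "sip_val T \<psi> \<sigma> = {\<psi>'. literal_conj \<psi>' \<and> lits \<psi>' = {l \<in> lits \<psi>. sat T \<sigma> l}}"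

definition sip_fm :: "('f, 'q, 's) background \<Rightarrow> ('f, 'q, 's) fm \<Rightarrow> ('f, 'q, 's) fm set" where
  "sip_fm T \<psi> = (\<Union>\<sigma>\<in>{\<sigma>. valuation T \<sigma> \<and> sat T \<sigma> \<psi>}. sip_val T \<psi> \<sigma>)"

definition sip :: "('f, 'q, 's) background \<Rightarrow> ('p, 'f, 'q, 's) chc set \<Rightarrow>
    ('p, 'f, 'q, 's) chc set" where
  "sip T \<Pi> = (\<Union>\<phi>\<in>\<Pi>. with_cond \<phi> ` sip_fm T (cond \<phi>))"

definition redundant :: "('f, 'q, 's) background \<Rightarrow> ('p, 'f, 'q, 's) chc \<Rightarrow>
    ('p, 'f, 'q, 's) chc set \<Rightarrow> bool" where
  "redundant T \<phi> \<Pi> \<longleftrightarrow> (\<exists>\<pi>\<in>\<Pi>. grnd T \<phi> \<subseteq> grnd T \<pi>)"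

definition strictly_redundant :: "('f, 'q, 's) background \<Rightarrow> ('p, 'f, 'q, 's) chc \<Rightarrow>
    ('p, 'f, 'q, 's) chc set \<Rightarrow> bool" where
  "strictly_redundant T \<phi> \<Pi> \<longleftrightarrow> (\<exists>\<pi>\<in>\<Pi>. grnd T \<phi> \<subset> grnd T \<pi>)"


section \<open>The ADCL calculus\<close>

text \<open>
  Proper states additionally record the current background theory.  A trace of length \<open>k\<close> comes
  with \<open>k + 1\<close> sets of blocking clauses.
\<close>

datatype ('p, 'f, 'q, 's) state =
    Problem "('p, 'f, 'q, 's) chc set"
  | State "('f, 'q, 's) background" "('p, 'f, 'q, 's) chc set" "('p, 'f, 'q, 's) chc list"
      "('p, 'f, 'q, 's) chc set list"
  | Unsat
  | Sat

definition active :: "('f, 'q, 's) background \<Rightarrow> ('p, 'f, 'q, 's) chc list \<Rightarrow>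
    ('p, 'f, 'q, 's) chc set list \<Rightarrow> ('p, 'f, 'q, 's) chc \<Rightarrow> bool" where
  "active T \<phi>s Bs \<phi> \<longleftrightarrow>
     \<not> redundant T \<phi> (last Bs) \<and> satisfiable_fm T (cond (res_seq (\<phi>s @ [\<phi>])))"

definition bt :: "('f, 'q, 's) background \<Rightarrow> ('p, 'f, 'q, 's) chc set \<Rightarrow>
    ('p, 'f, 'q, 's) chc list \<Rightarrow> ('p, 'f, 'q, 's) chc set list \<Rightarrow> ('p, 'f, 'q, 's) state" where
  "bt T \<Pi> \<phi>s Bs = State T \<Pi> (butlast \<phi>s)
     (butlast (butlast Bs) @ [last (butlast Bs) \<union> {last \<phi>s}])"

text \<open>
  Rule \<open>Backtrack\<close> must not be applied to a conditional empty clause either: otherwise the problem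
  consisting only of \<open>\<top> \<Rightarrow> \<bottom>\<close> could be classified as satisfiable, by \<open>Step\<close>, \<open>Backtrack\<close> and
  \<open>Prove\<close>.
\<close>

inductive adcl :: "('f, 'q, 's) background \<Rightarrow>
    (('f, 'q, 's) background \<Rightarrow> ('p, 'f, 'q, 's) chc \<Rightarrow>
      ('f, 'q, 's) background \<times> ('p, 'f, 'q, 's) chc) \<Rightarrow>
    ('p, 'f, 'q, 's) chc set \<Rightarrow> ('p, 'f, 'q, 's) state \<Rightarrow> ('p, 'f, 'q, 's) state \<Rightarrow> bool"
  for A accel \<Phi> where
  Init: "adcl A accel \<Phi> (Problem \<Phi>) (State A \<Phi> [] [{}])"
| Step: "adcl A accel \<Phi> (State T \<Pi> \<phi>s Bs) (State T \<Pi> (\<phi>s @ [\<phi>]) (Bs @ [{}]))"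
  if "\<phi> \<in> sip T \<Pi>" and "active T \<phi>s Bs \<phi>"
| Accelerate: "adcl A accel \<Phi> (State T \<Pi> (\<phi>s @ \<phi>s') (Bs @ Bs'))
    (State T' (\<Pi> \<union> {\<phi>}) (\<phi>s @ [\<phi>]) (Bs @ [{\<phi>}]))"
  if "\<phi>s' \<noteq> []" and "recursive (res_seq \<phi>s')" and "length \<phi>s' = length Bs'"
    and "accel T (res_seq \<phi>s') = (T', \<phi>)"
| Covered: "adcl A accel \<Phi> (State T \<Pi> (\<phi>s @ \<phi>s') Bs) (bt T \<Pi> (\<phi>s @ \<phi>s') Bs)"
  if "\<phi>s' \<noteq> []"
    and "strictly_redundant T (res_seq \<phi>s') (sip T \<Pi>) \<or>
      redundant T (res_seq \<phi>s') (sip T \<Pi>) \<and> length \<phi>s' > 1"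
| Backtrack: "adcl A accel \<Phi> (State T \<Pi> (\<phi>s @ [\<phi>]) Bs) (bt T \<Pi> (\<phi>s @ [\<phi>]) Bs)"
  if "\<forall>\<pi>\<in>sip T \<Pi>. is_rule \<pi> \<or> is_query \<pi> \<longrightarrow> \<not> active T (\<phi>s @ [\<phi>]) Bs \<pi>"
    and "\<not> is_query \<phi>" and "\<not> is_conditional_empty \<phi>"
| Refute: "adcl A accel \<Phi> (State T \<Pi> \<phi>s Bs) Unsat"
  if "\<phi>s \<noteq> []" and "is_refutation T (res_seq \<phi>s)"
| Prove: "adcl A accel \<Phi> (State T \<Pi> [] [B]) Sat"
  if "\<forall>\<pi>\<in>sip T \<Pi>. is_fact \<pi> \<or> is_conditional_empty \<pi> \<longrightarrow> \<not> active T [] [B] \<pi>"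

end

theory Submission
  imports Defs
begin

text \<open>
  On ground instances, resolution is composition of relations, so a clause set can only derive
  paths in the graph \<open>E\<close> of ground instances of \<open>\<Phi>\<close>, and \<open>\<Phi>\<close> is unsatisfiable iff \<open>E\<close> has a path from
  \<open>\<top>\<close> to \<open>\<bottom>\<close>.  This yields soundness of \<open>unsat\<close>.

  For \<open>sat\<close>, measure a ground atom by its distance to \<open>\<bottom>\<close> in \<open>E\<close>.  Each blocking clause \<open>b\<close> at position
  \<open>i\<close> is either strictly covered by a syntactic implicant, or every distance-decreasing derivation
  along the first \<open>i\<close> clauses of the trace and then \<open>b\<close> can be improved: one of its steps can be
  replaced by an instance of a clause in \<open>\<Pi>\<close> that ends closer to \<open>\<bottom>\<close>.  Unlike statements about
  shortest refutations, this stays true when acceleration enlarges \<open>\<Pi>\<close>.  If all continuations of a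
  derivation are blocked, consider one that ends closest to \<open>\<bottom>\<close> and a maximal clause among the
  finitely many ones blocking it: that clause is not strictly covered and the last step cannot be
  improved, hence an earlier one can.  For the empty trace there is no earlier step, so no refutation
  exists when \<open>Prove\<close> applies.
\<close>

section \<open>Substitutions and evaluation\<close>

lemma eval_subst_trm: "eval T \<sigma> (subst_trm \<theta> t) = eval T (\<lambda>x. eval T \<sigma> (\<theta> x)) t"
  by (induction t) (auto cong: map_cong)

text \<open>\<open>subst_fm\<close> does not avoid capture, so quantifiers have to be excluded
  here.\<close>

lemma sat_subst_fm:
  "quantifier_free \<psi> \<Longrightarrow> sat T \<sigma> (subst_fm \<theta> \<psi>) \<longleftrightarrow> sat T (\<lambda>x. eval T \<sigma> (\<theta> x)) \<psi>"
  by (induction \<psi>) (auto simp: eval_subst_trm comp_def)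

lemma subst_trm_subst_trm: "subst_trm \<theta> (subst_trm \<theta>' t) = subst_trm (\<lambda>x. subst_trm \<theta> (\<theta>' x)) t"
  by (induction t) (auto cong: map_cong)

lemma subst_fm_subst_fm:
  "quantifier_free \<psi> \<Longrightarrow> subst_fm \<theta> (subst_fm \<theta>' \<psi>) = subst_fm (\<lambda>x. subst_trm \<theta> (\<theta>' x)) \<psi>"
  by (induction \<psi>) (auto simp: subst_trm_subst_trm)

lemma subst_atom_subst_atom:
  "subst_atom \<theta> (subst_atom \<theta>' a) = subst_atom (\<lambda>x. subst_trm \<theta> (\<theta>' x)) a"
  by (simp add: subst_atom_def subst_trm_subst_trm)

lemma eval_cong: "(\<And>x. x \<in> vars_trm t \<Longrightarrow> \<sigma> x = \<tau> x) \<Longrightarrow> eval T \<sigma> t = eval T \<tau> t"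
proof (induction t)
  case (Fun f ts)
  then have "map (eval T \<sigma>) ts = map (eval T \<tau>) ts" by auto
  then show ?case by (metis eval.simps(2))
qed auto

lemma sat_cong:
  "quantifier_free \<psi> \<Longrightarrow> (\<And>x. x \<in> vars_fm \<psi> \<Longrightarrow> \<sigma> x = \<tau> x) \<Longrightarrow> sat T \<sigma> \<psi> \<longleftrightarrow> sat T \<tau> \<psi>"
proof (induction \<psi>)
  case (Eq s t)
  then have "eval T \<sigma> s = eval T \<tau> s" "eval T \<sigma> t = eval T \<tau> t"
    by (auto intro!: eval_cong)
  then show ?case by simp
next
  case (Pred q ts)
  then have "map (eval T \<sigma>) ts = map (eval T \<tau>) ts"
    by (auto intro!: eval_cong)
  then show ?case by (metis sat.simps(4))
qed auto

lemma vars_subst_trm: "vars_trm (subst_trm (Var \<circ> f) t) = f ` vars_trm t"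
  by (induction t) auto

lemma vars_subst_fm: "quantifier_free \<psi> \<Longrightarrow> vars_fm (subst_fm (Var \<circ> f) \<psi>) = f ` vars_fm \<psi>"
  by (induction \<psi>) (auto simp: vars_subst_trm)

lemma vars_subst_atom: "vars_atom (subst_atom (Var \<circ> f) a) = f ` vars_atom a"
  by (auto simp: vars_atom_def subst_atom_def vars_subst_trm)

lemma vars_subst_chc:
  "quantifier_free (cond \<phi>) \<Longrightarrow> vars_chc (subst_chc (Var \<circ> f) \<phi>) = f ` vars_chc \<phi>"
  by (auto simp: vars_chc_def subst_chc_def vars_subst_fm vars_subst_atom option.set_map
      image_Un image_UN)

lemma finite_vars_trm: "finite (vars_trm t)"
  by (induction t) auto

lemma finite_vars_chc: "finite (vars_chc \<phi>)"
proof -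
  have "finite (vars_fm \<psi>)" for \<psi> :: "('f, 'q, 's) fm"
    by (induction \<psi>) (auto simp: finite_vars_trm)
  then show ?thesis
    by (auto simp: vars_chc_def vars_atom_def finite_vars_trm)
qed

lemma has_sort_subst_trm:
  assumes "has_sort t s" "\<And>x. vsort (f x) = vsort x"
  shows "has_sort (subst_trm (Var \<circ> f) t) s"
  using assms(1)
proof (induction rule: has_sort.induct)
  case (1 x)
  then show ?case using has_sort.intros(1)[of "f x"] assms(2) by simp
next
  case (2 ts g)
  then have "list_all2 has_sort (map (subst_trm (Var \<circ> f)) ts) (fdom g)"
    by (auto simp: list_all2_conv_all_nth comp_def)
  then show ?case by (simp add: has_sort.intros comp_def)
qed

lemma funs_subst_trm: "funs_trm (subst_trm (Var \<circ> f) t) = funs_trm t"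
  by (induction t) auto

lemma term_over_subst_trm:
  "term_over T t s \<Longrightarrow> (\<And>x. vsort (f x) = vsort x) \<Longrightarrow> term_over T (subst_trm (Var \<circ> f) t) s"
  by (auto simp: term_over_def has_sort_subst_trm funs_subst_trm vars_subst_trm)

lemma fm_over_subst_fm:
  assumes "\<And>x. vsort (f x) = vsort x"
  shows "quantifier_free \<psi> \<Longrightarrow> fm_over T \<psi> \<Longrightarrow> fm_over T (subst_fm (Var \<circ> f) \<psi>)"
proof (induction \<psi>)
  case (Eq s t)
  then obtain s' where "term_over T s s'" "term_over T t s'" by auto
  then have "term_over T (subst_trm (Var \<circ> f) s) s'" "term_over T (subst_trm (Var \<circ> f) t) s'"
    using assms by (auto intro!: term_over_subst_trm)
  then show ?case unfolding fm_over.simps subst_fm.simps by blast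
next
  case (Pred q ts)
  then have "list_all2 (term_over T) (map (subst_trm (Var \<circ> f)) ts) (pdom q)"
    using assms by (auto simp: list_all2_conv_all_nth intro!: term_over_subst_trm)
  then show ?case using Pred by (simp add: comp_def)
qed auto

lemma quantifier_free_subst_fm: "quantifier_free (subst_fm \<theta> \<psi>) \<longleftrightarrow> quantifier_free \<psi>"
  by (induction \<psi>) auto

lemma atomic_subst_fm: "atomic (subst_fm \<theta> \<psi>) \<longleftrightarrow> atomic \<psi>"
  by (cases \<psi>) auto

lemma nnf_subst_fm: "nnf \<psi> \<Longrightarrow> quantifier_free \<psi> \<Longrightarrow> nnf (subst_fm \<theta> \<psi>)"
  by (induction \<psi>) (auto simp: atomic_subst_fm)

lemma literal_conj_subst_fm: "literal_conj \<psi> \<Longrightarrow> literal_conj (subst_fm \<theta> \<psi>)"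
  by (induction \<psi>) (auto simp: atomic_subst_fm)

lemma fm_over_vsort: "quantifier_free \<psi> \<Longrightarrow> fm_over T \<psi> \<Longrightarrow> x \<in> vars_fm \<psi> \<Longrightarrow> vsort x \<in> sorts T"
proof (induction \<psi>)
  case (Pred q ts)
  then show ?case by (fastforce simp: term_over_def list_all2_conv_all_nth in_set_conv_nth)
qed (auto simp: term_over_def)


section \<open>Ground instances\<close>

lemma is_chcE:
  assumes "is_chc \<Sigma> T \<phi>"
  obtains X Y where "flat \<Sigma> T (body \<phi>) X" "flat \<Sigma> T (head \<phi>) Y" "distinct (X @ Y)"
    "fm_over T (cond \<phi>)" "quantifier_free (cond \<phi>)" "nnf (cond \<phi>)"
  using assms unfolding is_chc_def by blast

lemma flat_vars: "flat \<Sigma> T a X \<Longrightarrow> (\<Union>b\<in>set_option a. vars_atom b) = set X"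
  by (cases "(\<Sigma>, T, a, X)" rule: flat.cases) (auto simp: vars_atom_def)

lemma flat_vsort: "flat \<Sigma> T a X \<Longrightarrow> x \<in> set X \<Longrightarrow> vsort x \<in> sorts T"
  by (cases "(\<Sigma>, T, a, X)" rule: flat.cases) (auto dest!: arg_cong[of "map vsort X" _ set])

lemma flat_subst:
  "flat \<Sigma> T a X \<Longrightarrow> (\<And>x. vsort (f x) = vsort x) \<Longrightarrow>
    flat \<Sigma> T (map_option (subst_atom (Var \<circ> f)) a) (map f X)"
  by (cases "(\<Sigma>, T, a, X)" rule: flat.cases) (auto simp: subst_atom_def comp_def)

lemma flat_Some:
  "flat \<Sigma> T (Some a) X \<longleftrightarrow>
    pred a \<in> \<Sigma> \<and> a = Atom (pred a) (map Var X) \<and> map vsort X = pdom (pred a) \<and>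
    set (pdom (pred a)) \<subseteq> sorts T"
  by (cases a) auto

text \<open>Valuations are constrained only at the sorts of \<open>T\<close>. A clause over
  \<open>T\<close> has no variables of other sorts, so values there can be altered without affecting
  it.\<close>

lemma vars_chc_vsort: "is_chc \<Sigma> T \<phi> \<Longrightarrow> x \<in> vars_chc \<phi> \<Longrightarrow> vsort x \<in> sorts T"
  by (erule is_chcE) (auto simp: vars_chc_def flat_vars dest: fm_over_vsort flat_vsort)

lemma map_option_subst_atom_cong:
  "(\<And>x. x \<in> (\<Union>b\<in>set_option a. vars_atom b) \<Longrightarrow> \<sigma> x = \<tau> x) \<Longrightarrow> flat \<Sigma> T a X \<Longrightarrow>
    map_option (subst_atom \<sigma>) a = map_option (subst_atom \<tau>) a"
  by (cases "(\<Sigma>, T, a, X)" rule: flat.cases) (auto simp: subst_atom_def vars_atom_def)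

lemma grndI:
  "valuation T \<sigma> \<Longrightarrow> sat T \<sigma> (cond \<phi>) \<Longrightarrow> x = map_option (subst_atom \<sigma>) (body \<phi>) \<Longrightarrow>
    y = map_option (subst_atom \<sigma>) (head \<phi>) \<Longrightarrow> (x, y) \<in> grnd T \<phi>"
  unfolding grnd_def by blast

lemma grndE:
  assumes "(x, y) \<in> grnd T \<phi>"
  obtains \<sigma> where "valuation T \<sigma>" "sat T \<sigma> (cond \<phi>)" "x = map_option (subst_atom \<sigma>) (body \<phi>)"
    "y = map_option (subst_atom \<sigma>) (head \<phi>)"
  using assms unfolding grnd_def by blast

lemma grnd_nonempty_iff: "grnd T \<phi> \<noteq> {} \<longleftrightarrow> satisfiable_fm T (cond \<phi>)"
  by (auto simp: grnd_def satisfiable_fm_def)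

lemma grnd_conditional_empty:
  "is_conditional_empty \<phi> \<Longrightarrow> satisfiable_fm T (cond \<phi>) \<Longrightarrow> (None, None) \<in> grnd T \<phi>"
  by (auto simp: grnd_def satisfiable_fm_def is_conditional_empty_def)

section \<open>Ground instances of clause sets and their truth\<close>

definition grnds :: "('f, 'q, 's) background \<Rightarrow> ('p, 'f, 'q, 's) chc set \<Rightarrow>
    (('p, 'f, 's) atom option \<times> ('p, 'f, 's) atom option) set" where
  "grnds T \<Pi> = (\<Union>\<phi>\<in>\<Pi>. grnd T \<phi>)"

text \<open>The flag is the truth value of a missing atom: \<open>True\<close> for bodies,
  \<open>False\<close> for heads.\<close>

fun holds :: "('p, 'f, 's) interp \<Rightarrow> bool \<Rightarrow> ('p, 'f, 's) atom option \<Rightarrow> bool" where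
  "holds I v None \<longleftrightarrow> v"
| "holds I v (Some a) \<longleftrightarrow> I (pred a) (args a)"

text \<open>The arguments of a flat atom are variables, for which instantiating with
  \<open>\<sigma>\<close> and evaluating under \<open>\<sigma>\<close> coincide.\<close>

lemma holds_flat:
  "flat \<Sigma> T a X \<Longrightarrow>
    holds I v (map_option (subst_atom \<sigma>) a) \<longleftrightarrow> (case a of None \<Rightarrow> v | Some b \<Rightarrow> sat_atom T I \<sigma> b)"
  by (cases "(\<Sigma>, T, a, X)" rule: flat.cases) (auto simp: subst_atom_def sat_atom_def comp_def)

lemma sat_chc_iff:
  assumes "is_chc \<Sigma> T \<phi>"
  shows "sat_chc T I \<phi> \<longleftrightarrow> (\<forall>(x, y)\<in>grnd T \<phi>. holds I True x \<longrightarrow> holds I False y)"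
  using assms
  by (elim is_chcE) (fastforce simp: sat_chc_def grnd_def holds_flat)

lemma univ_nonempty: "background_theory T \<Longrightarrow> s \<in> sorts T \<Longrightarrow> \<exists>t. t \<in> univ T s"
  unfolding background_theory_def ground_term_structure_def by blast

lemma univ_has_sort: "background_theory T \<Longrightarrow> s \<in> sorts T \<Longrightarrow> t \<in> univ T s \<Longrightarrow> has_sort t s"
  unfolding background_theory_def ground_term_structure_def term_over_def by blast


section \<open>Resolution composes ground instances\<close>

text \<open>Relational composition whose middle point must be an atom: \<open>None\<close> stands
  for \<bottom> as a head but for \<top> as a body, so the two must not be matched.\<close>

definition cmp :: "('a option \<times> 'a option) set \<Rightarrow> ('a option \<times> 'a option) set \<Rightarrow>
    ('a option \<times> 'a option) set" where
  "cmp R S = {(x, z). \<exists>a. (x, Some a) \<in> R \<and> (Some a, z) \<in> S}"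

section \<open>Most general unifiers of flat atoms\<close>

definition unifier_at :: "'s var list \<Rightarrow> 's var list \<Rightarrow> ('f, 's) subst" where
  "unifier_at X Y v = (case map_of (zip Y X) v of None \<Rightarrow> Var v | Some x \<Rightarrow> Var x)"

lemma unifier_at_notin: "v \<notin> set Y \<Longrightarrow> unifier_at X Y v = Var v"
  by (auto simp: unifier_at_def split: option.split dest: map_of_SomeD set_zip_leftD)

lemma unifier_at_nth:
  "distinct Y \<Longrightarrow> length X = length Y \<Longrightarrow> i < length Y \<Longrightarrow> unifier_at X Y (Y ! i) = Var (X ! i)"
  by (simp add: unifier_at_def map_of_zip_nth)

lemma unifier_at_image:
  assumes "distinct Y" "length X = length Y" "set X \<inter> set Y = {}"
  shows "map (unifier_at X Y) X = map (unifier_at X Y) Y"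
  using assms by (intro nth_equalityI) (auto simp: unifier_at_nth unifier_at_notin disjoint_iff)

lemma sorted_unifier_at:
  assumes "map vsort X = map vsort Y"
  shows "sorted_subst (unifier_at X Y)"
proof -
  have len: "length X = length Y" using assms map_eq_imp_length_eq by blast
  have "vsort x = vsort v" if "map_of (zip Y X) v = Some x" for v x
  proof -
    from that have "(v, x) \<in> set (zip Y X)" by (rule map_of_SomeD)
    then obtain i where "i < length Y" "v = Y ! i" "x = X ! i" by (auto simp: set_zip)
    then show ?thesis using assms len by (metis nth_map)
  qed
  then show ?thesis
    by (auto simp: sorted_subst_def unifier_at_def split: option.split)
      (metis has_sort.intros(1))+
qed

text \<open>\<open>unifier_at X Y\<close> sends each variable of \<open>Y\<close> to the one at the
  same position of \<open>X\<close> and fixes the rest. A unifier \<open>\<tau>\<close> takes equal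
  values at matching positions, so it absorbs this substitution; \<open>\<tau>\<close> itself is the
  factor that generality asks for.\<close>

lemma mgu_unifier_at:
  assumes "distinct Y" "set X \<inter> set Y = {}" "map vsort X = map vsort Y"
  shows "is_mgu (unifier_at X Y) (Atom F (map Var X)) (Atom F (map Var Y))"
proof -
  have len: "length X = length Y" using assms(3) map_eq_imp_length_eq by blast
  have "\<tau> v = subst_trm \<tau> (unifier_at X Y v)" if "map \<tau> X = map \<tau> Y" for \<tau> v
  proof (cases "v \<in> set Y")
    case True
    then obtain i where "i < length Y" "v = Y ! i" by (auto simp: in_set_conv_nth)
    then show ?thesis
      using arg_cong[OF that, of "\<lambda>l. l ! i"] len by (simp add: unifier_at_nth[OF assms(1)])
  qed (simp add: unifier_at_notin)
  then show ?thesis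
    using assms unifier_at_image[OF assms(1) len assms(2)] sorted_unifier_at[OF assms(3)]
    by (auto simp: is_mgu_def subst_atom_def comp_def)
qed

text \<open>
  Since the unifier above maps variables to variables, so does every most general unifier, and it
  identifies no further variables.
\<close>

lemma mgu_flatE:
  fixes \<theta> :: "('f, 's) subst"
  assumes "is_mgu \<theta> (Atom F (map Var X)) (Atom G (map Var Y))"
    and "distinct Y" "set X \<inter> set Y = {}" "map vsort X = map vsort Y" "F = G"
  obtains t where "\<theta> = Var \<circ> t" "\<And>x. vsort (t x) = vsort x" "map t X = map t Y"
    "inj_on t (- set Y)"
proof -
  let ?u = "unifier_at X Y"
  \<comment> \<open>The explicit unifier factors through \<open>\<theta>\<close>. Its values are
    variables, so those of \<open>\<theta>\<close> are too; it fixes everything outside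
    \<open>Y\<close>, so \<open>\<theta>\<close> is injective there.\<close>
  obtain \<delta> where \<delta>: "\<And>x. ?u x = subst_trm \<delta> (\<theta> x)"
    using assms(1) mgu_unifier_at[OF assms(2-4), of F] \<open>F = G\<close> unfolding is_mgu_def by blast
  have "\<exists>y. \<theta> x = Var y" for x
  proof (cases "\<theta> x")
    case (Fun f ts)
    then show ?thesis using \<delta>[of x] by (auto simp: unifier_at_def split: option.splits)
  qed auto
  then obtain t where t: "\<And>x. \<theta> x = Var (t x)" by metis
  have sorted: "sorted_subst \<theta>" and unify: "map t X = map t Y"
  proof -
    show "sorted_subst \<theta>" using assms(1) by (simp add: is_mgu_def)
    have "map Var (map t X) = (map Var (map t Y) :: ('f, 's) strm list)"
      using assms(1) t by (auto simp: is_mgu_def subst_atom_def comp_def)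
    then show "map t X = map t Y" by (auto intro: map_injective injI)
  qed
  show ?thesis
  proof
    show "\<theta> = Var \<circ> t" using t by auto
    show "vsort (t x) = vsort x" for x
      using sorted t[of x] by (auto simp: sorted_subst_def elim: has_sort.cases dest!: spec[of _ x])
    show "map t X = map t Y" by (rule unify)
    show "inj_on t (- set Y)"
    proof (rule inj_onI)
      fix x y assume "x \<in> - set Y" "y \<in> - set Y" "t x = t y"
      then have "(Var x :: ('f, 's) strm) = Var y"
        using \<delta>[of x] \<delta>[of y] t by (simp add: unifier_at_notin)
      then show "x = y" by simp
    qed
  qed
qed

text \<open>A renaming followed by a variable-valued unifier is again a map of variables,
  \<open>f\<close> on the first premise and \<open>f'\<close> on the second; this hides which
  renamings and which unifier were chosen. The last fact is the lifting property: instances of the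
  premises that agree on the resolved atom come from one common substitution.\<close>

lemma resolventE:
  fixes \<phi> \<phi>' :: "('p, 'f, 'q, 's) chc"
  assumes \<phi>: "is_chc \<Sigma> T \<phi>" and \<phi>': "is_chc \<Sigma> T \<phi>'" and "resolvent \<phi> \<phi>' \<chi>"
  obtains f f' F X Y where
    "\<chi> = CHC (map_option (subst_atom (Var \<circ> f)) (body \<phi>))
       (And (subst_fm (Var \<circ> f) (cond \<phi>)) (subst_fm (Var \<circ> f') (cond \<phi>')))
       (map_option (subst_atom (Var \<circ> f')) (head \<phi>'))"
    "\<And>x. vsort (f x) = vsort x" "\<And>x. vsort (f' x) = vsort x"
    "head \<phi> = Some (Atom F (map Var X))" "body \<phi>' = Some (Atom F (map Var Y))"
    "map f X = map f' Y" "is_chc \<Sigma> T \<chi>"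
    "\<And>\<sigma> \<sigma>' :: ('f, 's) subst. sorted_subst \<sigma> \<Longrightarrow> sorted_subst \<sigma>' \<Longrightarrow> map \<sigma> X = map \<sigma>' Y \<Longrightarrow>
       \<exists>\<delta>. (\<forall>x\<in>vars_chc \<phi>. \<delta> (f x) = \<sigma> x) \<and> (\<forall>x\<in>vars_chc \<phi>'. \<delta> (f' x) = \<sigma>' x)"
proof -
  obtain W X where X: "flat \<Sigma> T (body \<phi>) W" "flat \<Sigma> T (head \<phi>) X" "distinct (W @ X)"
    and qf: "fm_over T (cond \<phi>)" "quantifier_free (cond \<phi>)" "nnf (cond \<phi>)"
    by (rule is_chcE[OF \<phi>])
  obtain Y Z where Y: "flat \<Sigma> T (body \<phi>') Y" "flat \<Sigma> T (head \<phi>') Z" "distinct (Y @ Z)"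
    and qf': "fm_over T (cond \<phi>')" "quantifier_free (cond \<phi>')" "nnf (cond \<phi>')"
    by (rule is_chcE[OF \<phi>'])
  have vars: "set W \<subseteq> vars_chc \<phi>" "set X \<subseteq> vars_chc \<phi>" "set Y \<subseteq> vars_chc \<phi>'" "set Z \<subseteq> vars_chc \<phi>'"
    by (auto simp: vars_chc_def flat_vars[OF X(1)] flat_vars[OF X(2)] flat_vars[OF Y(1)]
        flat_vars[OF Y(2)])
  obtain \<rho> \<rho>' a b \<theta> where ren: "renaming \<rho>" "renaming \<rho>'"
    and disj: "vars_chc (subst_chc (Var \<circ> \<rho>) \<phi>) \<inter> vars_chc (subst_chc (Var \<circ> \<rho>') \<phi>') = {}"
    and ab: "head (subst_chc (Var \<circ> \<rho>) \<phi>) = Some a" "body (subst_chc (Var \<circ> \<rho>') \<phi>') = Some b"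
    and mgu: "is_mgu \<theta> a b"
    and \<chi>: "\<chi> = subst_chc \<theta> (CHC (body (subst_chc (Var \<circ> \<rho>) \<phi>))
      (And (cond (subst_chc (Var \<circ> \<rho>) \<phi>)) (cond (subst_chc (Var \<circ> \<rho>') \<phi>')))
      (head (subst_chc (Var \<circ> \<rho>') \<phi>')))"
    using assms(3) unfolding resolvent_def by blast
  have disj: "\<rho> ` vars_chc \<phi> \<inter> \<rho>' ` vars_chc \<phi>' = {}"
    using disj qf(2) qf'(2) by (simp add: vars_subst_chc)
  have inj: "inj \<rho>" "inj \<rho>'" and srt: "\<And>x. vsort (\<rho> x) = vsort x" "\<And>x. vsort (\<rho>' x) = vsort x"
    using ren by (auto simp: renaming_def bij_def)
  obtain F where F: "head \<phi> = Some (Atom F (map Var X))" "map vsort X = pdom F"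
    and a: "a = Atom F (map Var (map \<rho> X))"
    using ab(1) X(2) by (cases "head \<phi>") (auto simp: subst_chc_def subst_atom_def flat_Some comp_def)
  obtain G where G: "body \<phi>' = Some (Atom G (map Var Y))" "map vsort Y = pdom G"
    and b: "b = Atom G (map Var (map \<rho>' Y))"
    using ab(2) Y(1) by (cases "body \<phi>'") (auto simp: subst_chc_def subst_atom_def flat_Some comp_def)
  have "F = G"
    using mgu a b by (simp add: is_mgu_def subst_atom_def)
  have disjXY: "set (map \<rho> X) \<inter> set (map \<rho>' Y) = {}" and distY: "distinct (map \<rho>' Y)"
    using Int_mono[OF image_mono[OF vars(2)] image_mono[OF vars(3)], of \<rho> \<rho>'] disj Y(3)
      inj_on_subset[OF inj(2) subset_UNIV]
    by (simp_all add: distinct_map)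
  have "map vsort (map \<rho> X) = map vsort (map \<rho>' Y)"
    using F(2) G(2) \<open>F = G\<close> srt by (simp add: comp_def)
  then obtain t where t: "\<theta> = Var \<circ> t" "\<And>x. vsort (t x) = vsort x"
    and tXY: "map t (map \<rho> X) = map t (map \<rho>' Y)" and inj_t: "inj_on t (- set (map \<rho>' Y))"
    using mgu_flatE[OF mgu[unfolded a b] distY disjXY] \<open>F = G\<close> by metis
  define f f' where "f = t \<circ> \<rho>" and "f' = t \<circ> \<rho>'"
  have f: "\<And>x. vsort (f x) = vsort x" "\<And>x. vsort (f' x) = vsort x"
    using t(2) srt by (auto simp: f_def f'_def)
  have \<chi>': "\<chi> = CHC (map_option (subst_atom (Var \<circ> f)) (body \<phi>))
       (And (subst_fm (Var \<circ> f) (cond \<phi>)) (subst_fm (Var \<circ> f') (cond \<phi>')))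
       (map_option (subst_atom (Var \<circ> f')) (head \<phi>'))"
    unfolding \<chi> t(1) f_def f'_def
    by (simp add: subst_chc_def option.map_comp comp_def subst_atom_subst_atom subst_fm_subst_fm
        qf(2) qf'(2))
  have "\<rho>' ` set Z \<inter> \<rho>' ` set Y = {}"
    using Y(3) by (auto simp: inj_eq[OF inj(2)])
  then have notY: "\<rho> ` set W \<inter> set (map \<rho>' Y) = {}" "\<rho>' ` set Z \<inter> set (map \<rho>' Y) = {}"
    "\<rho> ` set W \<inter> \<rho>' ` set Z = {}"
    using Int_mono[OF image_mono[OF vars(1)] image_mono[OF vars(3)], of \<rho> \<rho>']
      Int_mono[OF image_mono[OF vars(1)] image_mono[OF vars(4)], of \<rho> \<rho>'] disj
    by simp_all
  \<comment> \<open>The unifier is injective off the renamed \<open>Y\<close>. The remaining body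
    and head variables lie there, so they stay pairwise distinct and the resolvent is flat
    again.\<close>
  have "inj_on t (\<rho> ` set W \<union> \<rho>' ` set Z)"
    using notY by (intro inj_on_subset[OF inj_t]) blast
  moreover have "distinct (map \<rho> W @ map \<rho>' Z)"
    using notY(3) X(3) Y(3) inj_on_subset[OF inj(1) subset_UNIV] inj_on_subset[OF inj(2) subset_UNIV]
    by (simp add: distinct_map)
  ultimately have "distinct (map t (map \<rho> W @ map \<rho>' Z))"
    by (subst distinct_map) simp
  then have dist: "distinct (map f W @ map f' Z)"
    by (simp add: f_def f'_def)
  have "is_chc \<Sigma> T \<chi>"
    unfolding is_chc_def \<chi>'
    using flat_subst[OF X(1) f(1)] flat_subst[OF Y(2) f(2)] dist qf qf' f
    by (auto simp: quantifier_free_subst_fm nnf_subst_fm fm_over_subst_fm simp del: distinct_append)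
  moreover have "\<exists>\<delta>. (\<forall>x\<in>vars_chc \<phi>. \<delta> (f x) = \<sigma> x) \<and> (\<forall>x\<in>vars_chc \<phi>'. \<delta> (f' x) = \<sigma>' x)"
    if \<sigma>: "sorted_subst \<sigma>" "sorted_subst \<sigma>'" "map \<sigma> X = map \<sigma>' Y" for \<sigma> \<sigma>' :: "('f, 's) subst"
  proof -
    \<comment> \<open>The two substitutions are glued along the disjoint renamed variable sets. On
      variables of neither premise only the sort of the value matters, and the second branch
      provides a well-sorted one.\<close>
    define \<tau> where "\<tau> v = (if v \<in> \<rho> ` vars_chc \<phi> then \<sigma> (inv \<rho> v) else \<sigma>' (inv \<rho>' v))" for v
    have \<tau>: "\<tau> (\<rho> x) = \<sigma> x" if "x \<in> vars_chc \<phi>" for x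
      using that inj(1) by (simp add: \<tau>_def)
    have \<tau>': "\<tau> (\<rho>' x) = \<sigma>' x" if "x \<in> vars_chc \<phi>'" for x
    proof -
      have "\<rho>' x \<notin> \<rho> ` vars_chc \<phi>" using disj that by blast
      then show ?thesis using inj(2) by (simp add: \<tau>_def)
    qed
    have surj: "surj \<rho>" "surj \<rho>'" using ren by (auto simp: renaming_def bij_def)
    have "has_sort (\<tau> v) (vsort v)" for v
      using \<sigma>(1,2) srt(1)[of "inv \<rho> v"] srt(2)[of "inv \<rho>' v"] surj
      by (simp add: \<tau>_def sorted_subst_def surj_f_inv_f) metis
    then have "sorted_subst \<tau>" by (simp add: sorted_subst_def)
    moreover have "map \<tau> (map \<rho> X) = map \<tau> (map \<rho>' Y)"
    proof -
      have "map \<tau> (map \<rho> X) = map \<sigma> X" using \<tau> vars by auto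
      moreover have "map \<tau> (map \<rho>' Y) = map \<sigma>' Y" using \<tau>' vars by auto
      ultimately show ?thesis using \<sigma>(3) by simp
    qed
    ultimately obtain \<delta> where "\<And>x. \<tau> x = subst_trm \<delta> (\<theta> x)"
      using mgu \<open>F = G\<close> unfolding is_mgu_def a b by (auto simp: subst_atom_def comp_def)
    then have "\<delta> (f x) = \<tau> (\<rho> x)" "\<delta> (f' x) = \<tau> (\<rho>' x)" for x
      using t(1) by (auto simp: f_def f'_def)
    then show ?thesis using \<tau> \<tau>' by (intro exI[of _ \<delta>]) simp
  qed
  moreover have "body \<phi>' = Some (Atom F (map Var Y))" "map f X = map f' Y"
    using G(1) \<open>F = G\<close> tXY by (simp_all add: f_def f'_def)
  ultimately show thesis
    using that[OF \<chi>' f F(1)] by blast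
qed

text \<open>An instance of the resolvent is pulled back along \<open>f\<close> and \<open>f'\<close>
  to instances of the premises that share the resolved atom. Conversely, valuations of the premises
  are merged by the lifting property, and the result is repaired to become a valuation.\<close>

lemma grnd_resolvent:
  fixes \<phi> \<phi>' :: "('p, 'f, 'q, 's) chc"
  assumes T: "background_theory T" and \<phi>: "is_chc \<Sigma> T \<phi>" and \<phi>': "is_chc \<Sigma> T \<phi>'"
    and "resolvent \<phi> \<phi>' \<chi>"
  shows "grnd T \<chi> = cmp (grnd T \<phi>) (grnd T \<phi>')"
proof -
  obtain f f' F X Y where
    \<chi>: "\<chi> = CHC (map_option (subst_atom (Var \<circ> f)) (body \<phi>))
       (And (subst_fm (Var \<circ> f) (cond \<phi>)) (subst_fm (Var \<circ> f') (cond \<phi>')))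
       (map_option (subst_atom (Var \<circ> f')) (head \<phi>'))"
    and f: "\<And>x. vsort (f x) = vsort x" "\<And>x. vsort (f' x) = vsort x"
    and F: "head \<phi> = Some (Atom F (map Var X))" "body \<phi>' = Some (Atom F (map Var Y))"
    and XY: "map f X = map f' Y"
    and lift: "\<And>\<sigma> \<sigma>' :: ('f, 's) subst. sorted_subst \<sigma> \<Longrightarrow> sorted_subst \<sigma>' \<Longrightarrow> map \<sigma> X = map \<sigma>' Y \<Longrightarrow>
       \<exists>\<delta>. (\<forall>x\<in>vars_chc \<phi>. \<delta> (f x) = \<sigma> x) \<and> (\<forall>x\<in>vars_chc \<phi>'. \<delta> (f' x) = \<sigma>' x)"
    by (rule resolventE[OF assms(2-4)]) blast
  obtain W X' where W: "flat \<Sigma> T (body \<phi>) W" and X': "flat \<Sigma> T (head \<phi>) X'"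
    and qf: "quantifier_free (cond \<phi>)"
    by (rule is_chcE[OF \<phi>])
  obtain Z Y' where Z: "flat \<Sigma> T (head \<phi>') Z" and Y': "flat \<Sigma> T (body \<phi>') Y'"
    and qf': "quantifier_free (cond \<phi>')"
    by (rule is_chcE[OF \<phi>'])
  have XY': "set X \<subseteq> vars_chc \<phi>" "set Y \<subseteq> vars_chc \<phi>'"
    by (auto simp: vars_chc_def F vars_atom_def)
  have atom: "subst_atom \<sigma> (Atom F (map Var V)) = Atom F (map \<sigma> V)" for \<sigma> :: "('f, 's) subst" and V
    by (simp add: subst_atom_def)
  show ?thesis
  proof (intro equalityI subrelI)
    fix x z assume "(x, z) \<in> grnd T \<chi>"
    then obtain \<delta> where val: "valuation T \<delta>" and sat: "sat T \<delta> (cond \<chi>)"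
      and x: "x = map_option (subst_atom \<delta>) (body \<chi>)" and z: "z = map_option (subst_atom \<delta>) (head \<chi>)"
      by (rule grndE)
    have "valuation T (\<delta> \<circ> f)" "valuation T (\<delta> \<circ> f')"
      using val f by (auto simp: valuation_def) metis+
    moreover have "sat T (\<delta> \<circ> f) (cond \<phi>)" "sat T (\<delta> \<circ> f') (cond \<phi>')"
      using sat qf qf' by (simp_all add: \<chi> sat_subst_fm comp_def)
    moreover have "x = map_option (subst_atom (\<delta> \<circ> f)) (body \<phi>)"
      "z = map_option (subst_atom (\<delta> \<circ> f')) (head \<phi>')"
      unfolding x z \<chi> by (simp_all add: option.map_comp comp_def subst_atom_subst_atom)
    moreover have "map_option (subst_atom (\<delta> \<circ> f)) (head \<phi>) = Some (Atom F (map \<delta> (map f X)))"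
      "map_option (subst_atom (\<delta> \<circ> f')) (body \<phi>') = Some (Atom F (map \<delta> (map f X)))"
      unfolding XY by (simp_all add: F atom XY[symmetric]) (simp_all add: XY flip: map_map)
    ultimately show "(x, z) \<in> cmp (grnd T \<phi>) (grnd T \<phi>')"
      unfolding cmp_def by (auto intro!: exI[of _ "Atom F (map \<delta> (map f X))"] intro: grndI)
  next
    fix x z assume "(x, z) \<in> cmp (grnd T \<phi>) (grnd T \<phi>')"
    then obtain a where "(x, Some a) \<in> grnd T \<phi>" "(Some a, z) \<in> grnd T \<phi>'"
      by (auto simp: cmp_def)
    then obtain \<sigma> \<sigma>' where val: "valuation T \<sigma>" "valuation T \<sigma>'"
      and sat: "sat T \<sigma> (cond \<phi>)" "sat T \<sigma>' (cond \<phi>')"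
      and x: "x = map_option (subst_atom \<sigma>) (body \<phi>)" and z: "z = map_option (subst_atom \<sigma>') (head \<phi>')"
      and a: "map \<sigma> X = map \<sigma>' Y"
      by (elim grndE) (auto simp: F atom)
    \<comment> \<open>Lifting asks for sorted substitutions, but a valuation may be ill-sorted at
      sorts foreign to \<open>T\<close>. Resetting it there leaves all clause variables
      unchanged.\<close>
    define cut where "cut \<sigma> x = (if vsort x \<in> sorts T then \<sigma> x else Var x)" for \<sigma> :: "('f, 's) subst" and x
    have cut_sorted: "sorted_subst (cut \<sigma>)" if "valuation T \<sigma>" for \<sigma>
      using that T has_sort.intros(1) by (auto simp: sorted_subst_def cut_def valuation_def univ_has_sort)
    have cut: "cut \<sigma> x = \<sigma> x" if "x \<in> vars_chc \<phi> \<union> vars_chc \<phi>'" for \<sigma> x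
      using that vars_chc_vsort[OF \<phi>] vars_chc_vsort[OF \<phi>'] by (auto simp: cut_def)
    have "map (cut \<sigma>) X = map (cut \<sigma>') Y"
    proof -
      have "map (cut \<sigma>) X = map \<sigma> X" "map (cut \<sigma>') Y = map \<sigma>' Y" using XY' cut by auto
      then show ?thesis using a by simp
    qed
    then obtain \<delta> where \<delta>: "\<And>x. x \<in> vars_chc \<phi> \<Longrightarrow> \<delta> (f x) = \<sigma> x"
      "\<And>x. x \<in> vars_chc \<phi>' \<Longrightarrow> \<delta> (f' x) = \<sigma>' x"
      using lift[OF cut_sorted cut_sorted] val cut by (metis UnCI)
    \<comment> \<open>\<open>\<delta>\<close> is merely a substitution, so its values may fall
      outside the carriers at variables that come from neither premise. There an arbitrary carrier
      element is taken.\<close>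
    define \<epsilon> where "\<epsilon> v = (if v \<in> f ` vars_chc \<phi> \<union> f' ` vars_chc \<phi>' then \<delta> v else
      (SOME t. t \<in> univ T (vsort v)))" for v
    have "\<epsilon> v \<in> univ T (vsort v)" if "vsort v \<in> sorts T" for v
    proof (cases "v \<in> f ` vars_chc \<phi> \<union> f' ` vars_chc \<phi>'")
      case True
      then show ?thesis using val \<delta> that f by (auto simp: \<epsilon>_def valuation_def)
    next
      case False
      then show ?thesis using someI_ex[OF univ_nonempty[OF T that]] by (simp only: \<epsilon>_def if_False)
    qed
    then have "valuation T \<epsilon>" by (simp add: valuation_def)
    have \<epsilon>: "\<And>x. x \<in> vars_chc \<phi> \<Longrightarrow> \<epsilon> (f x) = \<sigma> x" "\<And>x. x \<in> vars_chc \<phi>' \<Longrightarrow> \<epsilon> (f' x) = \<sigma>' x"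
      using \<delta> by (auto simp: \<epsilon>_def)
    have "sat T (\<lambda>x. \<epsilon> (f x)) (cond \<phi>) \<longleftrightarrow> sat T \<sigma> (cond \<phi>)"
      "sat T (\<lambda>x. \<epsilon> (f' x)) (cond \<phi>') \<longleftrightarrow> sat T \<sigma>' (cond \<phi>')"
      using \<epsilon> by (auto simp: vars_chc_def intro!: sat_cong qf qf')
    then have "sat T \<epsilon> (cond \<chi>)" using sat by (simp add: \<chi> sat_subst_fm qf qf')
    moreover have "x = map_option (subst_atom \<epsilon>) (body \<chi>)"
      unfolding x \<chi> using \<epsilon>(1)
      by (auto simp: option.map_comp comp_def subst_atom_subst_atom vars_chc_def
          intro!: map_option_subst_atom_cong[OF _ W])
    moreover have "z = map_option (subst_atom \<epsilon>) (head \<chi>)"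
      unfolding z \<chi> using \<epsilon>(2)
      by (auto simp: option.map_comp comp_def subst_atom_subst_atom vars_chc_def
          intro!: map_option_subst_atom_cong[OF _ Z])
    ultimately show "(x, z) \<in> grnd T \<chi>" using \<open>valuation T \<epsilon>\<close> by (intro grndI)
  qed
qed

text \<open>With \<open>N\<close> above all names in \<open>U\<close>, swapping the name blocks
  \<open>{0..<N}\<close> and \<open>{N..<2 * N}\<close> is an involution, hence a bijection, and
  moves \<open>U\<close> to names that are at least \<open>N\<close>.\<close>

lemma renaming_apart:
  fixes U :: "'s var set"
  assumes "finite U"
  obtains \<rho> where "renaming \<rho>" "U \<inter> \<rho> ` U = {}"
proof -
  obtain N where N: "\<And>x. x \<in> U \<Longrightarrow> vname x < N"
    using finite_nat_set_iff_bounded[of "vname ` U"] assms by auto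
  define h where "h n = (if n < N then n + N else if n < 2 * N then n - N else n)" for n
  define \<rho> :: "'s var \<Rightarrow> 's var" where "\<rho> x = V (h (vname x)) (vsort x)" for x
  have "h (h n) = n" for n by (auto simp: h_def)
  then have "\<rho> (\<rho> x) = x" for x by (simp add: \<rho>_def)
  then have "bij \<rho>" by (intro o_bij[of \<rho>]) auto
  moreover have "vsort (\<rho> x) = vsort x" for x by (simp add: \<rho>_def)
  ultimately have "renaming \<rho>" by (simp add: renaming_def)
  moreover have "N \<le> vname (\<rho> x)" if "x \<in> U" for x
    using N[OF that] by (simp add: \<rho>_def h_def)
  then have "U \<inter> \<rho> ` U = {}" using N by fastforce
  ultimately show thesis by (rule that)
qed

text \<open>It suffices to move the second clause apart and to keep the first, renamed by
  \<open>id\<close>. Hence \<open>res\<close> falls back to its default only if the head of the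
  first clause and the body of the second have no common predicate.\<close>

lemma resolvent_exists:
  fixes \<phi> \<phi>' :: "('p, 'f, 'q, 's) chc"
  assumes \<phi>: "is_chc \<Sigma> T \<phi>" and \<phi>': "is_chc \<Sigma> T \<phi>'"
    and "head \<phi> = Some a" "body \<phi>' = Some b" "pred a = pred b"
  shows "\<exists>\<chi>. resolvent \<phi> \<phi>' \<chi>"
proof -
  obtain X where X: "flat \<Sigma> T (Some a) X" and qf: "quantifier_free (cond \<phi>)"
    using is_chcE[OF \<phi>] assms(3) by metis
  obtain Y Z where Y: "flat \<Sigma> T (Some b) Y" "distinct (Y @ Z)" and qf': "quantifier_free (cond \<phi>')"
    using is_chcE[OF \<phi>'] assms(4) by metis
  obtain \<rho> where \<rho>: "renaming \<rho>" "(vars_chc \<phi> \<union> vars_chc \<phi>') \<inter> \<rho> ` (vars_chc \<phi> \<union> vars_chc \<phi>') = {}"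
    using renaming_apart[of "vars_chc \<phi> \<union> vars_chc \<phi>'"] finite_vars_chc by blast
  have vars: "set X \<subseteq> vars_chc \<phi>" "set Y \<subseteq> vars_chc \<phi>'"
    using flat_vars[OF X] flat_vars[OF Y(1)] by (auto simp: vars_chc_def assms)
  have "is_mgu (unifier_at X (map \<rho> Y)) (Atom (pred a) (map Var X)) (Atom (pred a) (map Var (map \<rho> Y)))"
  proof (rule mgu_unifier_at)
    have "inj \<rho>" using \<rho>(1) by (simp add: renaming_def bij_def)
    then show "distinct (map \<rho> Y)"
      using Y(2) by (simp add: distinct_map inj_on_subset[OF _ subset_UNIV])
    show "set X \<inter> set (map \<rho> Y) = {}" using vars \<rho>(2) by auto
    show "map vsort X = map vsort (map \<rho> Y)"
      using X Y(1) \<rho>(1) assms(5) by (simp add: flat_Some renaming_def comp_def)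
  qed
  moreover have "a = Atom (pred a) (map Var X)" using X unfolding flat_Some by blast
  moreover have "subst_atom (Var \<circ> \<rho>) b = Atom (pred a) (map Var (map \<rho> Y))"
  proof -
    have "b = Atom (pred a) (map Var Y)" using Y(1) assms(5) unfolding flat_Some by simp
    then show ?thesis by (simp add: subst_atom_def comp_def)
  qed
  ultimately have "is_mgu (unifier_at X (map \<rho> Y)) a (subst_atom (Var \<circ> \<rho>) b)"
    by metis
  moreover have "subst_atom Var a = a" for a :: "('p, 'f, 's) atom"
  proof -
    have "subst_trm Var t = t" for t :: "('f, 's) strm" by (induction t) (auto intro: map_idI)
    then show ?thesis by (cases a) (simp add: subst_atom_def map_idI)
  qed
  ultimately have "is_mgu (unifier_at X (map \<rho> Y)) (subst_atom (Var \<circ> id) a) (subst_atom (Var \<circ> \<rho>) b)"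
    using assms(3) by simp
  moreover have "vars_chc (subst_chc (Var \<circ> id) \<phi>) \<inter> vars_chc (subst_chc (Var \<circ> \<rho>) \<phi>') = {}"
    using \<rho>(2) unfolding vars_subst_chc[OF qf] vars_subst_chc[OF qf'] by auto
  moreover have "renaming id" by (simp add: renaming_def)
  moreover have "head (subst_chc (Var \<circ> id) \<phi>) = Some (subst_atom (Var \<circ> id) a)"
    "body (subst_chc (Var \<circ> \<rho>) \<phi>') = Some (subst_atom (Var \<circ> \<rho>) b)"
    by (simp_all add: subst_chc_def assms)
  ultimately show ?thesis using \<rho>(1) unfolding resolvent_def by blast
qed

section \<open>The resolution function \<open>res\<close>\<close>

lemma is_chc_bot: "is_chc \<Sigma> T (CHC None Bot None)"
  by (simp add: is_chc_def)

lemma grnd_bot: "grnd T (CHC None Bot None) = {}"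
  by (simp add: grnd_def)

lemma is_chc_res:
  assumes "is_chc \<Sigma> T \<phi>" "is_chc \<Sigma> T \<phi>'"
  shows "is_chc \<Sigma> T (res \<phi> \<phi>')"
proof (cases "\<exists>\<chi>. resolvent \<phi> \<phi>' \<chi>")
  case True
  then have "resolvent \<phi> \<phi>' (res \<phi> \<phi>')" by (simp add: res_def someI_ex)
  then show ?thesis using resolventE[OF assms] by metis
qed (simp add: res_def is_chc_bot)

text \<open>If no resolvent exists, no ground head matches a ground body, so the composition is
  empty, and so are the ground instances of the default clause.\<close>

lemma grnd_res:
  assumes "background_theory T" "is_chc \<Sigma> T \<phi>" "is_chc \<Sigma> T \<phi>'"
  shows "grnd T (res \<phi> \<phi>') = cmp (grnd T \<phi>) (grnd T \<phi>')"
proof (cases "\<exists>\<chi>. resolvent \<phi> \<phi>' \<chi>")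
  case True
  then have "resolvent \<phi> \<phi>' (res \<phi> \<phi>')" by (simp add: res_def someI_ex)
  then show ?thesis by (rule grnd_resolvent[OF assms])
next
  case False
  have "cmp (grnd T \<phi>) (grnd T \<phi>') = {}"
  proof (rule ccontr)
    assume "cmp (grnd T \<phi>) (grnd T \<phi>') \<noteq> {}"
    then obtain a x z where "(x, Some a) \<in> grnd T \<phi>" "(Some a, z) \<in> grnd T \<phi>'"
      by (auto simp: cmp_def)
    then obtain \<sigma> \<sigma>' where "map_option (subst_atom \<sigma>) (head \<phi>) = Some a"
      "map_option (subst_atom \<sigma>') (body \<phi>') = Some a"
      by (metis grndE)
    then obtain c d where "head \<phi> = Some c" "body \<phi>' = Some d" "pred c = pred d"
      by (auto simp: subst_atom_def)
    then show False using False resolvent_exists[OF assms(2,3)] by blast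
  qed
  then show ?thesis using False by (simp add: res_def grnd_bot)
qed

text \<open>The default clause is tracked separately because its condition \<open>Bot\<close> is not
  a \<open>literal_conj\<close>. Once it arises it persists: having no head, it is never the left
  premise of a resolvent.\<close>

lemma conjunctive_res:
  assumes "conjunctive \<phi> \<or> \<phi> = CHC None Bot None" "conjunctive \<phi>'"
  shows "conjunctive (res \<phi> \<phi>') \<or> res \<phi> \<phi>' = CHC None Bot None"
proof (cases "\<exists>\<chi>. resolvent \<phi> \<phi>' \<chi>")
  case True
  then have r: "resolvent \<phi> \<phi>' (res \<phi> \<phi>')" by (simp add: res_def someI_ex)
  then have "head \<phi> \<noteq> None" by (auto simp: resolvent_def subst_chc_def)
  then have "conjunctive \<phi>" using assms(1) by auto
  with r assms(2) have "conjunctive (res \<phi> \<phi>')"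
    by (auto simp: resolvent_def conjunctive_def subst_chc_def literal_conj_subst_fm)
  then show ?thesis ..
qed (simp add: res_def)


section \<open>Sequences\<close>

lemma res_seq_snoc: "\<phi>s \<noteq> [] \<Longrightarrow> res_seq (\<phi>s @ [\<phi>]) = res (res_seq \<phi>s) \<phi>"
  by (induction \<phi>s rule: res_seq.induct) auto

lemma is_chc_res_seq: "\<phi>s \<noteq> [] \<Longrightarrow> \<forall>\<phi>\<in>set \<phi>s. is_chc \<Sigma> T \<phi> \<Longrightarrow> is_chc \<Sigma> T (res_seq \<phi>s)"
  by (induction \<phi>s rule: rev_nonempty_induct) (auto simp: res_seq_snoc is_chc_res)

lemma conjunctive_res_seq:
  assumes "\<phi>s \<noteq> []" "\<forall>\<phi>\<in>set \<phi>s. conjunctive \<phi>" "recursive (res_seq \<phi>s)"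
  shows "conjunctive (res_seq \<phi>s)"
proof -
  have "conjunctive (res_seq \<phi>s) \<or> res_seq \<phi>s = CHC None Bot None"
    using assms(1,2)
    by (induction \<phi>s rule: rev_nonempty_induct) (auto simp: res_seq_snoc conjunctive_res)
  then show ?thesis using assms(3) by (auto simp: recursive_def is_rule_def)
qed

lemma grnd_res_seq_snoc:
  assumes "background_theory T" "\<phi>s \<noteq> []" "\<forall>\<phi>\<in>set \<phi>s. is_chc \<Sigma> T \<phi>" "is_chc \<Sigma> T \<phi>"
  shows "grnd T (res_seq (\<phi>s @ [\<phi>])) = cmp (grnd T (res_seq \<phi>s)) (grnd T \<phi>)"
  using assms grnd_res[OF assms(1) is_chc_res_seq] by (simp add: res_seq_snoc)

lemma cmp_assoc: "cmp (cmp R S) S' = cmp R (cmp S S')"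
  by (auto simp: cmp_def)

lemma grnd_res_seq_append:
  assumes T: "background_theory T" and "\<phi>s \<noteq> []" "\<phi>s' \<noteq> []"
    and "\<forall>\<phi>\<in>set \<phi>s. is_chc \<Sigma> T \<phi>" "\<forall>\<phi>\<in>set \<phi>s'. is_chc \<Sigma> T \<phi>"
  shows "grnd T (res_seq (\<phi>s @ \<phi>s')) = cmp (grnd T (res_seq \<phi>s)) (grnd T (res_seq \<phi>s'))"
  using assms(3,5)
proof (induction \<phi>s' rule: rev_nonempty_induct)
  case (single \<phi>)
  then show ?case using grnd_res_seq_snoc[OF T assms(2,4)] by simp
next
  case (snoc \<phi> \<phi>s')
  then have "grnd T (res_seq ((\<phi>s @ \<phi>s') @ [\<phi>])) = cmp (grnd T (res_seq (\<phi>s @ \<phi>s'))) (grnd T \<phi>)"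
    using assms(4) by (intro grnd_res_seq_snoc[OF T, where \<Sigma> = \<Sigma>]) auto
  also have "\<dots> = cmp (grnd T (res_seq \<phi>s)) (cmp (grnd T (res_seq \<phi>s')) (grnd T \<phi>))"
    using snoc by (simp add: cmp_assoc)
  also have "cmp (grnd T (res_seq \<phi>s')) (grnd T \<phi>) = grnd T (res_seq (\<phi>s' @ [\<phi>]))"
    using snoc by (intro grnd_res_seq_snoc[OF T, where \<Sigma> = \<Sigma>, symmetric]) auto
  finally show ?case by simp
qed

section \<open>Paths in a graph of ground instances\<close>

inductive_set path :: "('a option \<times> 'a option) set \<Rightarrow> ('a option \<times> 'a option) set" for E where
  edge: "e \<in> E \<Longrightarrow> e \<in> path E"
| step: "(x, Some a) \<in> path E \<Longrightarrow> (Some a, z) \<in> E \<Longrightarrow> (x, z) \<in> path E"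

text \<open>Paths grow at their right end, so the induction runs over the second path.\<close>

lemma cmp_path: "cmp (path E) (path E) \<subseteq> path E"
proof -
  have "(Some a, z) \<in> path E \<Longrightarrow> (x, Some a) \<in> path E \<Longrightarrow> (x, z) \<in> path E" for x a z
    by (induction "(Some a, z)" arbitrary: z rule: path.induct) (auto intro: path.step)
  then show ?thesis by (auto simp: cmp_def)
qed

lemma grnd_res_seq_path:
  assumes "background_theory T" "\<phi>s \<noteq> []" "\<forall>\<phi>\<in>set \<phi>s. is_chc \<Sigma> T \<phi> \<and> grnd T \<phi> \<subseteq> path E"
  shows "grnd T (res_seq \<phi>s) \<subseteq> path E"
  using assms(2,3)
proof (induction \<phi>s rule: rev_nonempty_induct)
  case (snoc \<phi> \<phi>s)
  then have "grnd T (res_seq (\<phi>s @ [\<phi>])) = cmp (grnd T (res_seq \<phi>s)) (grnd T \<phi>)"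
    by (intro grnd_res_seq_snoc[OF assms(1), where \<Sigma> = \<Sigma>]) auto
  also have "\<dots> \<subseteq> cmp (path E) (path E)"
    using snoc unfolding cmp_def by fastforce
  also have "\<dots> \<subseteq> path E" by (rule cmp_path)
  finally show ?case .
qed auto


section \<open>Syntactic implicants\<close>

lemma finite_lits: "finite (lits \<psi>)"
  by (induction \<psi>) auto

lemma literal_lits: "l \<in> lits \<psi> \<Longrightarrow> literal l"
  by (induction \<psi>) (auto split: if_splits)

lemma lits_literal: "literal l \<Longrightarrow> lits l = {l}"
  by (cases l) auto

lemma literal_conj_literal: "literal l \<Longrightarrow> literal_conj l"
  by (cases l) auto

text \<open>This makes \<open>sip_val\<close> nonempty: the literals true under a valuation always
  have a conjunction that represents them.\<close>

lemma ex_literal_conj: "finite L \<Longrightarrow> \<forall>l\<in>L. literal l \<Longrightarrow> \<exists>\<psi>. literal_conj \<psi> \<and> lits \<psi> = L"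
proof (induction L rule: finite_induct)
  case empty
  have "literal_conj Top \<and> lits Top = {}" by simp
  then show ?case by blast
next
  case (insert l L)
  then obtain \<psi> where "literal_conj \<psi>" "lits \<psi> = L" by auto
  then have "literal_conj (And l \<psi>) \<and> lits (And l \<psi>) = insert l L"
    using insert.prems by (auto simp: lits_literal literal_conj_literal)
  then show ?case by blast
qed

lemma sat_literal_conj: "literal_conj \<psi> \<Longrightarrow> sat T \<sigma> \<psi> \<longleftrightarrow> (\<forall>l\<in>lits \<psi>. sat T \<sigma> l)"
  by (induction \<psi>) auto

text \<open>In negation normal form only atoms are negated, so truth is monotone in the set of true
  literals.\<close>

lemma sat_mono_lits:
  "quantifier_free \<psi> \<Longrightarrow> nnf \<psi> \<Longrightarrow> sat T \<sigma> \<psi> \<Longrightarrow> \<forall>l\<in>lits \<psi>. sat T \<sigma> l \<longrightarrow> sat T \<tau> l \<Longrightarrow>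
    sat T \<tau> \<psi>"
  by (induction \<psi>) auto

lemma fm_over_lits: "fm_over T \<psi> \<Longrightarrow> l \<in> lits \<psi> \<Longrightarrow> fm_over T l"
  by (induction \<psi>) (auto split: if_splits)

lemma literal_quantifier_free: "literal l \<Longrightarrow> quantifier_free l"
proof -
  have "atomic a \<Longrightarrow> quantifier_free a" for a :: "('f, 'q, 's) fm" by (cases a) auto
  then show "literal l \<Longrightarrow> quantifier_free l" by (cases l) auto
qed

lemma literal_conj_wf:
  "literal_conj \<psi> \<Longrightarrow> \<forall>l\<in>lits \<psi>. fm_over T l \<Longrightarrow> fm_over T \<psi> \<and> quantifier_free \<psi> \<and> nnf \<psi>"
proof (induction \<psi>)
  case (Neg \<psi>)
  then show ?case using literal_quantifier_free[of "Neg \<psi>"] by simp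
qed auto

text \<open>The valuation behind a ground instance also generates an implicant, and satisfies it.
  Hence passing to implicants loses no ground instance.\<close>

lemma grnds_subset_sip:
  assumes "(x, y) \<in> grnds T \<Pi>"
  obtains \<pi> where "\<pi> \<in> sip T \<Pi>" "(x, y) \<in> grnd T \<pi>"
proof -
  obtain \<phi> where "\<phi> \<in> \<Pi>" and "(x, y) \<in> grnd T \<phi>" using assms by (auto simp: grnds_def)
  from this(2) obtain \<sigma> where \<sigma>: "valuation T \<sigma>" "sat T \<sigma> (cond \<phi>)"
    "x = map_option (subst_atom \<sigma>) (body \<phi>)" "y = map_option (subst_atom \<sigma>) (head \<phi>)"
    by (rule grndE)
  have "finite {l \<in> lits (cond \<phi>). sat T \<sigma> l}" by (simp add: finite_lits)
  moreover have "\<forall>l\<in>{l \<in> lits (cond \<phi>). sat T \<sigma> l}. literal l" by (auto intro: literal_lits)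
  ultimately obtain \<psi> where \<psi>: "literal_conj \<psi>" "lits \<psi> = {l \<in> lits (cond \<phi>). sat T \<sigma> l}"
    using ex_literal_conj by blast
  then have "\<psi> \<in> sip_fm T (cond \<phi>)" using \<sigma> by (auto simp: sip_fm_def sip_val_def)
  moreover have "sat T \<sigma> \<psi>" using \<psi> by (simp add: sat_literal_conj)
  then have "(x, y) \<in> grnd T (with_cond \<phi> \<psi>)" using \<sigma> by (intro grndI) (auto simp: with_cond_def)
  ultimately show thesis using \<open>\<phi> \<in> \<Pi>\<close> by (intro that) (auto simp: sip_def)
qed

text \<open>By monotonicity in the literals, an implicant entails the condition it stems from. Hence
  passing to implicants adds no ground instance.\<close>

lemma sipE:
  assumes "\<pi> \<in> sip T \<Pi>" "\<forall>\<phi>\<in>\<Pi>. is_chc \<Sigma> T \<phi>"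
  obtains \<phi> where "\<phi> \<in> \<Pi>" "grnd T \<pi> \<subseteq> grnd T \<phi>" "is_chc \<Sigma> T \<pi>" "conjunctive \<pi>"
proof -
  obtain \<phi> \<psi> \<sigma> where \<phi>: "\<phi> \<in> \<Pi>" and \<pi>: "\<pi> = with_cond \<phi> \<psi>" and \<sigma>: "sat T \<sigma> (cond \<phi>)"
    and \<psi>: "literal_conj \<psi>" "lits \<psi> = {l \<in> lits (cond \<phi>). sat T \<sigma> l}"
    using assms(1) by (auto simp: sip_def sip_fm_def sip_val_def)
  have chc: "is_chc \<Sigma> T \<phi>" using assms(2) \<phi> by blast
  then have wf: "fm_over T (cond \<phi>)" "quantifier_free (cond \<phi>)" "nnf (cond \<phi>)"
    by (auto simp: is_chc_def)
  have "sat T \<tau> (cond \<phi>)" if "sat T \<tau> \<psi>" for \<tau>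
    using that sat_mono_lits[OF wf(2,3) \<sigma>] \<psi> by (auto simp: sat_literal_conj)
  then have "grnd T \<pi> \<subseteq> grnd T \<phi>" by (auto simp: \<pi> grnd_def with_cond_def)
  moreover have "fm_over T \<psi> \<and> quantifier_free \<psi> \<and> nnf \<psi>"
    using \<psi> fm_over_lits[OF wf(1)] by (intro literal_conj_wf) auto
  then have "is_chc \<Sigma> T \<pi>" using chc by (simp add: is_chc_def \<pi> with_cond_def)
  moreover have "conjunctive \<pi>" using \<psi> by (simp add: \<pi> conjunctive_def with_cond_def)
  ultimately show thesis using \<phi> by (intro that)
qed


section \<open>Richer theories\<close>

lemma richer_valuation: "richer T T' \<Longrightarrow> valuation T' \<sigma> \<Longrightarrow> valuation T \<sigma>"
  unfolding richer_def valuation_def by blast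

text \<open>The function symbols of \<open>T\<close> are interpreted alike only on arguments from
  the carriers of \<open>T\<close>, so membership in the carrier is proved together with
  agreement.\<close>

lemma richer_eval:
  assumes T: "background_theory T" and r: "richer T T'" and \<sigma>: "valuation T \<sigma>"
    and "term_over T t s"
  shows "eval T \<sigma> t \<in> univ T s \<and> eval T' \<sigma> t = eval T \<sigma> t"
proof -
  have "has_sort t s \<Longrightarrow> funs_trm t \<subseteq> funs T \<Longrightarrow> vsort ` vars_trm t \<subseteq> sorts T \<Longrightarrow>
    eval T \<sigma> t \<in> univ T s \<and> eval T' \<sigma> t = eval T \<sigma> t"
  proof (induction rule: has_sort.induct)
    case (1 x)
    then show ?case using \<sigma> by (simp add: valuation_def)
  next
    case (2 ts f)
    then have *: "i < length ts \<Longrightarrow>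
      eval T \<sigma> (ts ! i) \<in> univ T (fdom f ! i) \<and> eval T' \<sigma> (ts ! i) = eval T \<sigma> (ts ! i)" for i
      using nth_mem[of i ts] by (fastforce simp: list_all2_conv_all_nth)
    then have "list_all2 (\<lambda>t s. t \<in> univ T s) (map (eval T \<sigma>) ts) (fdom f)"
      using 2(1) by (auto simp: list_all2_conv_all_nth)
    moreover have eq: "map (eval T' \<sigma>) ts = map (eval T \<sigma>) ts"
      by (rule nth_equalityI) (simp_all add: *)
    moreover have "f \<in> funs T" using 2(2) by simp
    ultimately have "fint T f (map (eval T \<sigma>) ts) \<in> univ T (fcod f)"
      "fint T' f (map (eval T \<sigma>) ts) = fint T f (map (eval T \<sigma>) ts)"
      using T r unfolding background_theory_def ground_term_structure_def richer_def by blast+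
    then show ?case by (simp add: eq cong del: map_cong)
  qed
  then show ?thesis using assms(4) by (simp add: term_over_def)
qed

lemma richer_sat:
  assumes T: "background_theory T" and r: "richer T T'" and \<sigma>: "valuation T \<sigma>"
  shows "quantifier_free \<psi> \<Longrightarrow> fm_over T \<psi> \<Longrightarrow> sat T' \<sigma> \<psi> \<longleftrightarrow> sat T \<sigma> \<psi>"
proof (induction \<psi>)
  case (Eq s t)
  then obtain s' where "term_over T s s'" "term_over T t s'" by auto
  then show ?case using richer_eval[OF T r \<sigma>] by simp
next
  case (Pred q ts)
  then have "q \<in> preds T" and *: "list_all2 (term_over T) ts (pdom q)" by auto
  have "list_all2 (\<lambda>t s. t \<in> univ T s) (map (eval T \<sigma>) ts) (pdom q)"
    using * richer_eval[OF T r \<sigma>] by (auto simp: list_all2_conv_all_nth)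
  moreover have eq: "map (eval T' \<sigma>) ts = map (eval T \<sigma>) ts"
    using * richer_eval[OF T r \<sigma>] by (intro nth_equalityI) (auto simp: list_all2_conv_all_nth)
  ultimately have "pint T' q (map (eval T \<sigma>) ts) = pint T q (map (eval T \<sigma>) ts)"
    using r \<open>q \<in> preds T\<close> unfolding richer_def by blast
  then show ?case by (simp add: eq cong del: map_cong)
qed auto

lemma richer_subset:
  "richer T T' \<Longrightarrow> sorts T \<subseteq> sorts T' \<and> funs T \<subseteq> funs T' \<and> preds T \<subseteq> preds T'"
  by (simp add: richer_def)

lemma richer_term_over: "richer T T' \<Longrightarrow> term_over T t s \<Longrightarrow> term_over T' t s"
  by (drule richer_subset) (auto simp: term_over_def)

lemma richer_fm_over: "richer T T' \<Longrightarrow> fm_over T \<psi> \<Longrightarrow> fm_over T' \<psi>"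
proof (induction \<psi>)
  case (Eq s t)
  then obtain s' where "term_over T s s'" "term_over T t s'" by auto
  then have "term_over T' s s' \<and> term_over T' t s'" using Eq(1) by (simp add: richer_term_over)
  then show ?case by auto
next
  case (Pred q ts)
  then have "q \<in> preds T'" "list_all2 (term_over T) ts (pdom q)" by (auto dest: richer_subset)
  moreover from this(2) have "list_all2 (term_over T') ts (pdom q)"
    by (rule list_all2_mono) (rule richer_term_over[OF Pred(1)])
  ultimately show ?case by simp
qed (auto dest: richer_subset)

lemma richer_is_chc:
  fixes \<phi> :: "('p, 'f, 'q, 's) chc"
  assumes "richer T T'" "is_chc \<Sigma> T \<phi>"
  shows "is_chc \<Sigma> T' \<phi>"
proof -
  have "flat \<Sigma> T' a X" if "flat \<Sigma> T a X" for a :: "('p, 'f, 's) atom option" and X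
    using that richer_subset[OF assms(1)]
    by (cases "(\<Sigma>, T, a, X)" rule: flat.cases) auto
  then show ?thesis using assms richer_fm_over unfolding is_chc_def by metis
qed

lemma richer_extend_valuation:
  assumes "background_theory T'" "richer T T'" "valuation T \<sigma>"
  obtains \<sigma>' where "valuation T' \<sigma>'" "\<And>x. vsort x \<in> sorts T \<Longrightarrow> \<sigma>' x = \<sigma> x"
proof
  let ?\<sigma> = "\<lambda>x. if vsort x \<in> sorts T then \<sigma> x else (SOME t. t \<in> univ T' (vsort x))"
  show "valuation T' ?\<sigma>"
    using assms someI_ex[OF univ_nonempty[OF assms(1)]]
    by (auto simp: valuation_def richer_def)
qed auto

text \<open>Valuations of the richer theory are valuations of the old one, and old valuations can be
  extended by arbitrary elements at new sorts. A clause over \<open>T\<close> contains neither new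
  sorts nor new symbols and cannot tell the difference.\<close>

lemma richer_grnd:
  assumes T: "background_theory T" "background_theory T'" and r: "richer T T'"
    and \<phi>: "is_chc \<Sigma> T \<phi>"
  shows "grnd T' \<phi> = grnd T \<phi>"
proof -
  obtain X Y where flat: "flat \<Sigma> T (body \<phi>) X" "flat \<Sigma> T (head \<phi>) Y"
    and wf: "quantifier_free (cond \<phi>)" "fm_over T (cond \<phi>)"
    by (rule is_chcE[OF \<phi>])
  note sat = richer_sat[OF T(1) r _ wf]
  show ?thesis
  proof (intro equalityI subrelI)
    fix x y assume "(x, y) \<in> grnd T' \<phi>"
    then show "(x, y) \<in> grnd T \<phi>"
      by (elim grndE, intro grndI) (auto simp: sat dest: richer_valuation[OF r])
  next
    fix x y assume "(x, y) \<in> grnd T \<phi>"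
    then obtain \<sigma> where \<sigma>: "valuation T \<sigma>" "sat T \<sigma> (cond \<phi>)"
      "x = map_option (subst_atom \<sigma>) (body \<phi>)" "y = map_option (subst_atom \<sigma>) (head \<phi>)"
      by (rule grndE)
    obtain \<sigma>' where \<sigma>': "valuation T' \<sigma>'" "\<And>x. vsort x \<in> sorts T \<Longrightarrow> \<sigma>' x = \<sigma> x"
      using richer_extend_valuation[OF T(2) r \<sigma>(1)] by blast
    then have eq: "\<sigma>' x = \<sigma> x" if "x \<in> vars_chc \<phi>" for x
      using vars_chc_vsort[OF \<phi> that] by blast
    have "sat T \<sigma>' (cond \<phi>)"
      using \<sigma>(2) eq by (subst sat_cong[OF wf(1), of _ \<sigma>]) (auto simp: vars_chc_def)
    then have "sat T' \<sigma>' (cond \<phi>)" using sat richer_valuation[OF r] \<sigma>'(1) by blast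
    moreover have "x = map_option (subst_atom \<sigma>') (body \<phi>)" "y = map_option (subst_atom \<sigma>') (head \<phi>)"
      unfolding \<sigma> using eq flat
      by (auto simp: vars_chc_def intro!: map_option_subst_atom_cong)
    ultimately show "(x, y) \<in> grnd T' \<phi>" using \<sigma>'(1) by (intro grndI)
  qed
qed

text \<open>Extending a valuation keeps the truth value of every literal over \<open>T\<close>, so
  the extended valuation generates the same implicants.\<close>

lemma richer_sip:
  assumes T: "background_theory T" "background_theory T'" and r: "richer T T'"
    and \<Pi>: "\<forall>\<phi>\<in>\<Pi>. is_chc \<Sigma> T \<phi>"
  shows "sip T \<Pi> \<subseteq> sip T' \<Pi>"
proof
  fix \<pi> assume "\<pi> \<in> sip T \<Pi>"
  then obtain \<phi> \<psi> \<sigma> where \<phi>: "\<phi> \<in> \<Pi>" and \<pi>: "\<pi> = with_cond \<phi> \<psi>"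
    and \<sigma>: "valuation T \<sigma>" "sat T \<sigma> (cond \<phi>)"
    and \<psi>: "literal_conj \<psi>" "lits \<psi> = {l \<in> lits (cond \<phi>). sat T \<sigma> l}"
    by (auto simp: sip_def sip_fm_def sip_val_def)
  have wf: "fm_over T (cond \<phi>)" "quantifier_free (cond \<phi>)"
    using \<Pi> \<phi> by (auto simp: is_chc_def)
  obtain \<sigma>' where \<sigma>': "valuation T' \<sigma>'" "\<And>x. vsort x \<in> sorts T \<Longrightarrow> \<sigma>' x = \<sigma> x"
    using richer_extend_valuation[OF T(2) r \<sigma>(1)] by blast
  have eq: "sat T' \<sigma>' \<psi>' \<longleftrightarrow> sat T \<sigma> \<psi>'" if "fm_over T \<psi>'" "quantifier_free \<psi>'" for \<psi>'
  proof -
    have "sat T' \<sigma>' \<psi>' \<longleftrightarrow> sat T \<sigma>' \<psi>'"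
      using richer_sat[OF T(1) r richer_valuation[OF r \<sigma>'(1)]] that by blast
    also have "\<dots> \<longleftrightarrow> sat T \<sigma> \<psi>'"
      using that fm_over_vsort \<sigma>'(2) by (intro sat_cong) blast+
    finally show ?thesis .
  qed
  have "lits \<psi> = {l \<in> lits (cond \<phi>). sat T' \<sigma>' l}"
    unfolding \<psi>(2)
    using eq fm_over_lits[OF wf(1)] literal_lits literal_quantifier_free by blast
  then show "\<pi> \<in> sip T' \<Pi>"
    using \<phi> \<pi> \<sigma>'(1) \<sigma>(2) \<psi>(1) eq[OF wf] by (auto simp: sip_def sip_fm_def sip_val_def)
qed


section \<open>Distance to the empty clause\<close>

text \<open>\<open>None\<close> is read as a head here, that is as \<bottom>; the number counts the
  edges on the way to it.\<close>

inductive refutes ::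
  "('a option \<times> 'a option) set \<Rightarrow> 'a option \<Rightarrow> nat \<Rightarrow> bool" for E where
  "refutes E None 0"
| "(Some a, y) \<in> E \<Longrightarrow> refutes E y n \<Longrightarrow> refutes E (Some a) (Suc n)"

definition refutable :: "('a option \<times> 'a option) set \<Rightarrow> 'a option \<Rightarrow> bool" where
  "refutable E y \<longleftrightarrow> (\<exists>n. refutes E y n)"

text \<open>Meaningful for refutable nodes only, which is why \<open>derivation\<close> asks for
  refutability of every head.\<close>

definition dist :: "('a option \<times> 'a option) set \<Rightarrow> 'a option \<Rightarrow> nat" where
  "dist E y = (LEAST n. refutes E y n)"

lemma dist_step:
  assumes "refutable E (Some a)"
  obtains z where "(Some a, z) \<in> E" "refutable E z" "dist E z < dist E (Some a)"
proof -
  have "refutes E (Some a) (dist E (Some a))"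
    using assms LeastI_ex unfolding refutable_def dist_def by metis
  then obtain z n where "(Some a, z) \<in> E" "refutes E z n" "dist E (Some a) = Suc n"
    by (auto elim: refutes.cases)
  moreover from this(2) have "dist E z \<le> n" unfolding dist_def by (rule Least_le)
  ultimately show thesis using that unfolding refutable_def by fastforce
qed

text \<open>Refutability travels backwards from the end of the path to the end of its first edge. A
  path from \<top> to \<bottom> thus yields a first step of a refutation.\<close>

lemma path_refutable:
  "(x, y) \<in> path E \<Longrightarrow> refutable E y \<Longrightarrow> \<exists>z. (x, z) \<in> E \<and> refutable E z"
proof (induction "(x, y)" arbitrary: y rule: path.induct)
  case (step a z)
  then have "refutable E (Some a)" unfolding refutable_def by (blast intro: refutes.intros)
  then show ?case using step by blast
qed auto

text \<open>
  Only derivations that approach the empty clause with every step need to be tracked: skipping a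
  part of such a derivation, by \<open>Covered\<close> or \<open>Accelerate\<close>, decreases the distance.
\<close>

definition approaches :: "('a option \<times> 'a option) set \<Rightarrow> 'a option \<times> 'a option \<Rightarrow>
    'a option \<times> 'a option \<Rightarrow> bool" where
  "approaches E g g' \<longleftrightarrow> snd g \<noteq> None \<and> fst g' = snd g \<and> dist E (snd g') < dist E (snd g)"

definition derivation where
  "derivation T E \<phi>s gs \<longleftrightarrow> list_all2 (\<lambda>\<phi> g. g \<in> grnd T \<phi>) \<phi>s gs \<and> successively (approaches E) gs \<and>
     (\<forall>g\<in>set gs. refutable E (snd g))"

text \<open>Monotone in \<open>P\<close>. Hence improvements remain available when learned clauses
  enlarge the clause set, while distances are always measured in the fixed graph
  \<open>E\<close>.\<close>

definition improvable where
  "improvable P E gs \<longleftrightarrow>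
     (\<exists>g\<in>set gs. \<exists>y. (fst g, y) \<in> P \<and> refutable E y \<and> dist E y < dist E (snd g))"

lemma derivation_append:
  assumes "derivation T E (\<phi>s @ \<phi>s') gs"
  obtains gs' gs'' where "gs = gs' @ gs''" "derivation T E \<phi>s gs'" "derivation T E \<phi>s' gs''"
  using assms by (auto simp: derivation_def list_all2_append1 successively_append_iff)

lemma derivation_snoc:
  "derivation T E (\<phi>s @ [\<phi>]) (gs @ [g]) \<longleftrightarrow>
    derivation T E \<phi>s gs \<and> g \<in> grnd T \<phi> \<and> refutable E (snd g) \<and> (gs \<noteq> [] \<longrightarrow> approaches E (last gs) g)"
  using list_all2_rev[of "\<lambda>\<phi> g. g \<in> grnd T \<phi>" "\<phi>s @ [\<phi>]" "gs @ [g]"]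
  by (auto simp: derivation_def successively_append_iff)

lemma derivation_length: "derivation T E \<phi>s gs \<Longrightarrow> length gs = length \<phi>s"
  by (auto simp: derivation_def dest: list_all2_lengthD)

text \<open>Resolving the whole sequence jumps from the first body to the last head. Every step
  after the first decreases the distance, so from two clauses on the jump ends strictly closer than
  the first head.\<close>

lemma derivation_res_seq:
  assumes T: "background_theory T" and "\<phi>s \<noteq> []" "\<forall>\<phi>\<in>set \<phi>s. is_chc \<Sigma> T \<phi>" "derivation T E \<phi>s gs"
  shows "(fst (hd gs), snd (last gs)) \<in> grnd T (res_seq \<phi>s) \<and> dist E (snd (last gs)) \<le> dist E (snd (hd gs))
    \<and> (length \<phi>s > 1 \<longrightarrow> dist E (snd (last gs)) < dist E (snd (hd gs)))"
  using assms(2-4)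
proof (induction \<phi>s arbitrary: gs rule: rev_nonempty_induct)
  case (single \<phi>)
  then show ?case by (auto simp: derivation_def list_all2_Cons1)
next
  case (snoc \<phi> \<phi>s)
  obtain gs' g where gs: "gs = gs' @ [g]"
    using derivation_length[OF snoc.prems(2)] by (cases gs rule: rev_cases) auto
  have d: "derivation T E \<phi>s gs'" and g: "g \<in> grnd T \<phi>"
    using snoc.prems(2) by (auto simp: gs derivation_snoc)
  have "gs' \<noteq> []" using derivation_length[OF d] snoc.hyps by auto
  then have a: "approaches E (last gs') g"
    using snoc.prems(2) by (auto simp: gs derivation_snoc)
  have IH: "(fst (hd gs'), snd (last gs')) \<in> grnd T (res_seq \<phi>s)"
    "dist E (snd (last gs')) \<le> dist E (snd (hd gs'))"
    using snoc.IH[OF _ d] snoc.prems(1) by auto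
  obtain b where "snd (last gs') = Some b" "fst g = Some b" using a by (auto simp: approaches_def)
  then have "(fst (hd gs'), snd g) \<in> cmp (grnd T (res_seq \<phi>s)) (grnd T \<phi>)"
    using IH(1) g unfolding cmp_def by (cases g) auto
  then have "(fst (hd gs'), snd g) \<in> grnd T (res_seq (\<phi>s @ [\<phi>]))"
    using grnd_res_seq_snoc[OF T snoc.hyps, of \<Sigma> \<phi>] snoc.prems(1) by auto
  then show ?case using a IH(2) \<open>gs' \<noteq> []\<close> by (auto simp: gs approaches_def)
qed


section \<open>Blocking clauses\<close>

text \<open>\<open>\<phi>s\<close> is the trace in front of \<open>b\<close>. The improvement may
  concern any step, not only the one by \<open>b\<close>; this is what lets the obligation move to
  shorter traces.\<close>

definition justified where
  "justified T \<Pi> E \<phi>s b \<longleftrightarrow> (\<exists>\<pi>\<in>sip T \<Pi>. grnd T b \<subset> grnd T \<pi>) \<or>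
     (\<forall>gs. derivation T E (\<phi>s @ [b]) gs \<longrightarrow> improvable (grnds T \<Pi>) E gs)"

lemma improvable_of_blocked:
  assumes "finite B" and just: "\<forall>b\<in>B. justified T \<Pi> E \<phi>s b"
    and blocked: "\<And>\<pi> z. \<pi> \<in> sip T \<Pi> \<Longrightarrow> (x, z) \<in> grnd T \<pi> \<Longrightarrow> redundant T \<pi> B"
    and "(x, z0) \<in> grnds T \<Pi>" "refutable E z0"
    and deriv: "\<And>b z. (x, z) \<in> grnd T b \<Longrightarrow> refutable E z \<Longrightarrow> dist E z \<le> dist E z0 \<Longrightarrow>
      derivation T E (\<phi>s @ [b]) (gs @ [(x, z)])"
  shows "improvable (grnds T \<Pi>) E gs"
proof -
  \<comment> \<open>Minimality is over all ground instances of \<open>\<Pi>\<close> with body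
    \<open>x\<close>, so the step to \<open>z\<close> cannot be improved; the improvement found at
    the end has to concern a step of \<open>gs\<close>.\<close>
  obtain z where z: "(x, z) \<in> grnds T \<Pi>" "refutable E z"
    and min: "\<And>y. (x, y) \<in> grnds T \<Pi> \<Longrightarrow> refutable E y \<Longrightarrow> dist E z \<le> dist E y"
    using ex_has_least_nat[of "\<lambda>z. (x, z) \<in> grnds T \<Pi> \<and> refutable E z" z0 "dist E"] assms(4,5)
    by auto
  define C where "C = {b \<in> B. (x, z) \<in> grnd T b}"
  have C: "\<exists>b\<in>C. grnd T \<pi> \<subseteq> grnd T b" if "\<pi> \<in> sip T \<Pi>" "(x, z) \<in> grnd T \<pi>" for \<pi>
    using blocked[OF that] that unfolding redundant_def C_def by blast
  obtain \<pi> where "\<pi> \<in> sip T \<Pi>" "(x, z) \<in> grnd T \<pi>" using z(1) by (rule grnds_subset_sip)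
  then have "grnd T ` C \<noteq> {}" using C by blast
  moreover have "finite (grnd T ` C)" using assms(1) by (simp add: C_def)
  \<comment> \<open>If a maximal blocker were strictly covered by an implicant, that implicant would
    itself be blocked by an element of \<open>C\<close> with still more ground instances. A maximal
    one exists because \<open>B\<close> is finite.\<close>
  ultimately obtain m where "m \<in> grnd T ` C" and max: "\<forall>m'\<in>grnd T ` C. m \<subseteq> m' \<longrightarrow> m = m'"
    using finite_has_maximal by metis
  then obtain b where b: "b \<in> B" "(x, z) \<in> grnd T b" "m = grnd T b" by (auto simp: C_def)
  have "\<not> (\<exists>\<pi>\<in>sip T \<Pi>. grnd T b \<subset> grnd T \<pi>)"
  proof
    assume "\<exists>\<pi>\<in>sip T \<Pi>. grnd T b \<subset> grnd T \<pi>"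
    then obtain \<pi> where "\<pi> \<in> sip T \<Pi>" "grnd T b \<subset> grnd T \<pi>" by blast
    with C[of \<pi>] b(2) obtain b' where "b' \<in> C" "grnd T b \<subset> grnd T b'" by blast
    then show False using max b(3) by blast
  qed
  then have "improvable (grnds T \<Pi>) E (gs @ [(x, z)])"
    using just b deriv[OF b(2) z(2)] min[OF assms(4,5)] unfolding justified_def by blast
  then show ?thesis using min by (fastforce simp: improvable_def)
qed


section \<open>The calculus\<close>

text \<open>\<open>E\<close> stays fixed while the theory changes. Containment in
  \<open>path E\<close> is what soundness of \<open>unsat\<close> rests on, and justification of the
  blocking clauses is what soundness of \<open>sat\<close> rests on.\<close>

definition adcl_inv :: "('p, 's) psym set \<Rightarrow> ('f, 'q, 's) background set \<Rightarrow> ('p, 'f, 'q, 's) chc set \<Rightarrow>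
    (('p, 'f, 's) atom option \<times> ('p, 'f, 's) atom option) set \<Rightarrow> ('f, 'q, 's) background \<Rightarrow>
    ('p, 'f, 'q, 's) chc set \<Rightarrow> ('p, 'f, 'q, 's) chc list \<Rightarrow> ('p, 'f, 'q, 's) chc set list \<Rightarrow> bool" where
  "adcl_inv \<Sigma> \<T> \<Phi> E T \<Pi> \<phi>s Bs \<longleftrightarrow>
     T \<in> \<T> \<and> \<Phi> \<subseteq> \<Pi> \<and> grnds T \<Phi> = E \<and>
     (\<forall>\<phi>\<in>\<Pi> \<union> set \<phi>s \<union> \<Union> (set Bs). is_chc \<Sigma> T \<phi> \<and> grnd T \<phi> \<subseteq> path E) \<and>
     (\<forall>\<phi>\<in>set \<phi>s. conjunctive \<phi>) \<and> (\<forall>B\<in>set Bs. finite B) \<and> length Bs = Suc (length \<phi>s) \<and>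
     (\<forall>i\<le>length \<phi>s. \<forall>b\<in>Bs ! i. justified T \<Pi> E (take i \<phi>s) b)"

section \<open>The invariant under changes of the trace\<close>

lemma adcl_inv_append:
  assumes "adcl_inv \<Sigma> \<T> \<Phi> E T \<Pi> (\<phi>s @ \<phi>s') (Bs @ Bs')" "length \<phi>s' = length Bs'"
  shows "adcl_inv \<Sigma> \<T> \<Phi> E T \<Pi> \<phi>s Bs"
proof -
  have "length Bs = Suc (length \<phi>s)" using assms by (simp add: adcl_inv_def)
  moreover have "\<forall>i\<le>length \<phi>s. \<forall>b\<in>Bs ! i. justified T \<Pi> E (take i \<phi>s) b"
  proof (intro allI impI)
    fix i assume "i \<le> length \<phi>s"
    then have "(Bs @ Bs') ! i = Bs ! i" "take i (\<phi>s @ \<phi>s') = take i \<phi>s" "i \<le> length (\<phi>s @ \<phi>s')"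
      using \<open>length Bs = _\<close> by (auto simp: nth_append)
    then show "\<forall>b\<in>Bs ! i. justified T \<Pi> E (take i \<phi>s) b" using assms(1) unfolding adcl_inv_def by metis
  qed
  ultimately show ?thesis using assms(1) by (auto simp: adcl_inv_def)
qed

lemma adcl_inv_last: "adcl_inv \<Sigma> \<T> \<Phi> E T \<Pi> \<phi>s Bs \<Longrightarrow> \<forall>b\<in>last Bs. justified T \<Pi> E \<phi>s b"
  unfolding adcl_inv_def by (metis diff_Suc_1 last_conv_nth le_refl length_0_conv nat.distinct(1) take_all)

lemma adcl_inv_last_finite: "adcl_inv \<Sigma> \<T> \<Phi> E T \<Pi> \<phi>s Bs \<Longrightarrow> finite (last Bs)"
  unfolding adcl_inv_def by (metis last_in_set length_0_conv nat.distinct(1))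

lemma adcl_inv_step:
  assumes I: "adcl_inv \<Sigma> \<T> \<Phi> E T \<Pi> \<phi>s Bs" and "is_chc \<Sigma> T \<phi>" "grnd T \<phi> \<subseteq> path E" "conjunctive \<phi>"
    and B: "finite B" "\<forall>b\<in>B. is_chc \<Sigma> T b \<and> grnd T b \<subseteq> path E \<and> justified T \<Pi> E (\<phi>s @ [\<phi>]) b"
  shows "adcl_inv \<Sigma> \<T> \<Phi> E T \<Pi> (\<phi>s @ [\<phi>]) (Bs @ [B])"
proof -
  have len: "length Bs = Suc (length \<phi>s)" using I by (simp add: adcl_inv_def)
  have "justified T \<Pi> E (take i (\<phi>s @ [\<phi>])) b" if "i \<le> length (\<phi>s @ [\<phi>])" "b \<in> (Bs @ [B]) ! i" for i b
  proof (cases "i \<le> length \<phi>s")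
    case True
    then show ?thesis using that len I by (simp add: nth_append adcl_inv_def)
  next
    case False
    then have "i = Suc (length \<phi>s)" using that(1) by simp
    then show ?thesis using that(2) len B(2) by (simp add: nth_append)
  qed
  then show ?thesis using assms by (auto simp: adcl_inv_def)
qed

text \<open>The clause taken off the trace becomes a blocking clause for the shortened trace, so its
  justification is the only new obligation.\<close>

lemma adcl_inv_bt:
  assumes I: "adcl_inv \<Sigma> \<T> \<Phi> E T \<Pi> (\<phi>s @ [\<phi>]) Bs" and "justified T \<Pi> E \<phi>s \<phi>"
  obtains Bs' where "bt T \<Pi> (\<phi>s @ [\<phi>]) Bs = State T \<Pi> \<phi>s Bs'" "adcl_inv \<Sigma> \<T> \<Phi> E T \<Pi> \<phi>s Bs'"
proof -
  have len: "length Bs = Suc (Suc (length \<phi>s))" using I by (simp add: adcl_inv_def)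
  then obtain Cs' D where Bs': "Bs = Cs' @ [D]" "length Cs' = Suc (length \<phi>s)"
    by (cases Bs rule: rev_cases) auto
  then obtain Cs C where Bs: "Bs = (Cs @ [C]) @ [D]" "length Cs = length \<phi>s"
    by (cases Cs' rule: rev_cases) auto
  have I': "adcl_inv \<Sigma> \<T> \<Phi> E T \<Pi> \<phi>s (Cs @ [C])"
    using I adcl_inv_append[of _ _ _ _ _ _ \<phi>s "[\<phi>]" "Cs @ [C]" "[D]"] by (simp add: Bs)
  have "bt T \<Pi> (\<phi>s @ [\<phi>]) Bs = State T \<Pi> \<phi>s (Cs @ [C \<union> {\<phi>}])"
    by (simp add: bt_def Bs butlast_append)
  moreover have "adcl_inv \<Sigma> \<T> \<Phi> E T \<Pi> \<phi>s (Cs @ [C \<union> {\<phi>}])"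
  proof -
    have "justified T \<Pi> E (take i \<phi>s) b" if "i \<le> length \<phi>s" "b \<in> (Cs @ [C \<union> {\<phi>}]) ! i" for i b
    proof (cases "b \<in> (Cs @ [C]) ! i")
      case True
      then show ?thesis using that(1) I' by (simp add: adcl_inv_def)
    next
      case False
      then have "i = length \<phi>s \<and> b = \<phi>"
        using that Bs(2) by (auto simp: nth_append less_Suc_eq split: if_splits)
      then show ?thesis using assms(2) by simp
    qed
    then show ?thesis using I I' by (auto simp: adcl_inv_def)
  qed
  ultimately show thesis by (rule that)
qed

text \<open>
  If the covered suffix has several elements, skipping to its last atom is an improvement; if it
  has one element, it is strictly covered.
\<close>

lemma justified_covered:
  assumes I: "adcl_inv \<Sigma> \<T> \<Phi> E T \<Pi> (\<phi>s @ \<phi>s' @ [\<phi>]) Bs" and T: "background_theory T"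
    and cov: "strictly_redundant T (res_seq (\<phi>s' @ [\<phi>])) (sip T \<Pi>) \<or>
      redundant T (res_seq (\<phi>s' @ [\<phi>])) (sip T \<Pi>) \<and> \<phi>s' \<noteq> []"
  shows "justified T \<Pi> E (\<phi>s @ \<phi>s') \<phi>"
proof (cases "\<phi>s' = []")
  case True
  then show ?thesis using cov by (auto simp: justified_def strictly_redundant_def)
next
  case False
  have chc: "\<forall>\<phi>\<in>\<Pi>. is_chc \<Sigma> T \<phi>" using I by (simp add: adcl_inv_def)
  obtain \<pi> where \<pi>: "\<pi> \<in> sip T \<Pi>" "grnd T (res_seq (\<phi>s' @ [\<phi>])) \<subseteq> grnd T \<pi>"
    using cov unfolding strictly_redundant_def redundant_def by blast
  have sub: "grnd T (res_seq (\<phi>s' @ [\<phi>])) \<subseteq> grnds T \<Pi>"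
    using sipE[OF \<pi>(1) chc] \<pi>(2) unfolding grnds_def by blast
  have "improvable (grnds T \<Pi>) E gs" if "derivation T E ((\<phi>s @ \<phi>s') @ [\<phi>]) gs" for gs
  proof -
    from that have "derivation T E (\<phi>s @ \<phi>s' @ [\<phi>]) gs" by simp
    then obtain gs1 gs2 where gs: "gs = gs1 @ gs2" and d: "derivation T E (\<phi>s' @ [\<phi>]) gs2"
      by (rule derivation_append)
    have ne: "gs2 \<noteq> []" using derivation_length[OF d] by auto
    have "(fst (hd gs2), snd (last gs2)) \<in> grnds T \<Pi>" "dist E (snd (last gs2)) < dist E (snd (hd gs2))"
      using derivation_res_seq[OF T _ _ d, of \<Sigma>] I sub False by (auto simp: adcl_inv_def)
    moreover have "refutable E (snd (last gs2))" using d ne by (simp add: derivation_def)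
    ultimately show ?thesis using ne hd_in_set[OF ne] unfolding improvable_def gs by auto
  qed
  then show ?thesis by (auto simp: justified_def)
qed

text \<open>\<open>\<phi>\<close> has a head, so a derivation ends in some atom \<open>a\<close>,
  from which an edge of \<open>E\<close> leads closer to \<bottom>. The derivation itself witnesses
  that the trace can be continued by every implicant with a ground instance starting in
  \<open>a\<close>; being inactive, such implicants must therefore be blocked.\<close>

lemma justified_backtrack:
  assumes I: "adcl_inv \<Sigma> \<T> \<Phi> E T \<Pi> (\<phi>s @ [\<phi>]) Bs" and T: "background_theory T"
    and inactive: "\<forall>\<pi>\<in>sip T \<Pi>. is_rule \<pi> \<or> is_query \<pi> \<longrightarrow> \<not> active T (\<phi>s @ [\<phi>]) Bs \<pi>"
    and "\<not> is_query \<phi>" "\<not> is_conditional_empty \<phi>"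
  shows "justified T \<Pi> E \<phi>s \<phi>"
  unfolding justified_def
proof (intro disjI2 allI impI)
  fix gs assume d: "derivation T E (\<phi>s @ [\<phi>]) gs"
  have chc: "\<forall>\<phi>\<in>\<Pi>. is_chc \<Sigma> T \<phi>" "\<forall>\<psi>\<in>set (\<phi>s @ [\<phi>]). is_chc \<Sigma> T \<psi>" and "E \<subseteq> grnds T \<Pi>"
    using I by (auto simp: adcl_inv_def grnds_def)
  obtain gs' g where gs: "gs = gs' @ [g]"
    using derivation_length[OF d] by (cases gs rule: rev_cases) auto
  have "head \<phi> \<noteq> None" using assms(4,5) by (auto simp: is_query_def is_conditional_empty_def)
  moreover have g: "g \<in> grnd T \<phi>" "refutable E (snd g)" using d by (auto simp: gs derivation_snoc)
  ultimately obtain a where a: "snd g = Some a" by (auto simp: grnd_def)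
  then obtain z0 where z0: "(Some a, z0) \<in> E" "refutable E z0" "dist E z0 < dist E (Some a)"
    using g(2) by (auto elim: dist_step)
  have "redundant T \<pi> (last Bs)" if \<pi>: "\<pi> \<in> sip T \<Pi>" "(Some a, z) \<in> grnd T \<pi>" for \<pi> z
  proof -
    have "body \<pi> \<noteq> None" using \<pi>(2) by (cases "body \<pi>") (auto simp: grnd_def)
    then have "\<not> active T (\<phi>s @ [\<phi>]) Bs \<pi>"
      using inactive \<pi>(1) by (auto simp: is_rule_def is_query_def)
    moreover have "is_chc \<Sigma> T \<pi>" using sipE[OF \<pi>(1) chc(1)] by blast
    then have "grnd T (res_seq ((\<phi>s @ [\<phi>]) @ [\<pi>])) = cmp (grnd T (res_seq (\<phi>s @ [\<phi>]))) (grnd T \<pi>)"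
      using chc(2) by (intro grnd_res_seq_snoc[OF T]) auto
    moreover have "(fst (hd gs), Some a) \<in> grnd T (res_seq (\<phi>s @ [\<phi>]))"
      using derivation_res_seq[OF T _ chc(2) d] a by (simp add: gs)
    ultimately show ?thesis
      using \<pi>(2) unfolding active_def cmp_def grnd_nonempty_iff[symmetric] by blast
  qed
  then show "improvable (grnds T \<Pi>) E gs"
  proof (rule improvable_of_blocked[OF adcl_inv_last_finite[OF I] adcl_inv_last[OF I]])
    show "(Some a, z0) \<in> grnds T \<Pi>" using z0(1) \<open>E \<subseteq> _\<close> by blast
    show "derivation T E ((\<phi>s @ [\<phi>]) @ [b]) (gs @ [(Some a, z)])"
      if "(Some a, z) \<in> grnd T b" "refutable E z" "dist E z \<le> dist E z0" for b z
      using d that z0(3) a unfolding derivation_snoc by (simp add: gs approaches_def)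
  qed (use z0 in auto)
qed

text \<open>Ground instances of old clauses do not depend on which of the two theories is used,
  while implicants and ground instances of the clause set only grow. Both forms of justification
  therefore persist.\<close>

lemma adcl_inv_richer:
  assumes I: "adcl_inv \<Sigma> \<T> \<Phi> E T \<Pi> \<phi>s Bs" and T: "background_theory T" "background_theory T'"
    and r: "richer T T'" and "T' \<in> \<T>" and \<phi>: "is_chc \<Sigma> T' \<phi>" "grnd T' \<phi> \<subseteq> path E"
  shows "adcl_inv \<Sigma> \<T> \<Phi> E T' (\<Pi> \<union> {\<phi>}) \<phi>s Bs"
proof -
  have grnd: "grnd T' \<psi> = grnd T \<psi>" "is_chc \<Sigma> T' \<psi>" if "\<psi> \<in> \<Pi> \<union> set \<phi>s \<union> \<Union> (set Bs)" for \<psi>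
    using that I richer_grnd[OF T r] richer_is_chc[OF r] unfolding adcl_inv_def by blast+
  have "\<forall>\<phi>\<in>\<Pi>. is_chc \<Sigma> T \<phi>" using I by (simp add: adcl_inv_def)
  from richer_sip[OF T r this] have sips: "sip T \<Pi> \<subseteq> sip T' (\<Pi> \<union> {\<phi>})" by (auto simp: sip_def)
  have grnds: "grnds T \<Pi> \<subseteq> grnds T' (\<Pi> \<union> {\<phi>})" using grnd(1) by (auto simp: grnds_def)
  have deriv: "derivation T' E \<psi>s gs \<longleftrightarrow> derivation T E \<psi>s gs"
    if "set \<psi>s \<subseteq> \<Pi> \<union> set \<phi>s \<union> \<Union> (set Bs)" for \<psi>s gs
  proof -
    have "grnd T' \<psi> = grnd T \<psi>" if "\<psi> \<in> set \<psi>s" for \<psi>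
      using that \<open>set \<psi>s \<subseteq> _\<close> by (intro grnd(1)) blast
    then show ?thesis by (auto simp: derivation_def list_all2_conv_all_nth)
  qed
  have grnd_sip: "grnd T' \<pi> = grnd T \<pi>" if "\<pi> \<in> sip T \<Pi>" for \<pi>
    using sipE[OF that \<open>\<forall>\<phi>\<in>\<Pi>. is_chc \<Sigma> T \<phi>\<close>] richer_grnd[OF T r] by metis
  have just: "justified T' (\<Pi> \<union> {\<phi>}) E \<psi>s b"
    if j: "justified T \<Pi> E \<psi>s b" and sub: "set (\<psi>s @ [b]) \<subseteq> \<Pi> \<union> set \<phi>s \<union> \<Union> (set Bs)" for \<psi>s b
  proof -
    have b: "grnd T' b = grnd T b" using sub by (intro grnd(1)) auto
    from j consider \<pi> where "\<pi> \<in> sip T \<Pi>" "grnd T b \<subset> grnd T \<pi>"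
      | "\<forall>gs. derivation T E (\<psi>s @ [b]) gs \<longrightarrow> improvable (grnds T \<Pi>) E gs"
      unfolding justified_def by blast
    then show ?thesis
    proof cases
      case 1
      then have "\<pi> \<in> sip T' (\<Pi> \<union> {\<phi>})" "grnd T' b \<subset> grnd T' \<pi>" using sips grnd_sip b by auto
      then show ?thesis unfolding justified_def by blast
    next
      case 2
      then have "\<forall>gs. derivation T' E (\<psi>s @ [b]) gs \<longrightarrow> improvable (grnds T' (\<Pi> \<union> {\<phi>})) E gs"
        using deriv[OF sub] grnds unfolding improvable_def by blast
      then show ?thesis unfolding justified_def by blast
    qed
  qed
  have "grnds T' \<Phi> = grnds T \<Phi>" using grnd(1) I by (auto simp: grnds_def adcl_inv_def)
  moreover have "justified T' (\<Pi> \<union> {\<phi>}) E (take i \<phi>s) b" if "i \<le> length \<phi>s" "b \<in> Bs ! i" for i b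
  proof (rule just)
    show "justified T \<Pi> E (take i \<phi>s) b" using that I by (simp add: adcl_inv_def)
    have "Bs ! i \<in> set Bs" using that(1) I by (simp add: adcl_inv_def)
    then show "set (take i \<phi>s @ [b]) \<subseteq> \<Pi> \<union> set \<phi>s \<union> \<Union> (set Bs)"
      using that(2) set_take_subset[of i \<phi>s] by auto
  qed
  ultimately show ?thesis using I grnd \<phi> \<open>T' \<in> \<T>\<close> unfolding adcl_inv_def by auto
qed

text \<open>
  The accelerated clause is transitive, so that deriving with it twice is never necessary.
\<close>

lemma adcl_inv_accelerate:
  assumes I: "adcl_inv \<Sigma> \<T> \<Phi> E T \<Pi> (\<phi>s @ \<phi>s') (Bs @ Bs')" and \<T>: "\<forall>T\<in>\<T>. background_theory T"
    and acc: "acceleration_technique \<Sigma> \<T> accel"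
    and "\<phi>s' \<noteq> []" "recursive (res_seq \<phi>s')" "length \<phi>s' = length Bs'" "accel T (res_seq \<phi>s') = (T', \<phi>)"
  shows "adcl_inv \<Sigma> \<T> \<Phi> E T' (\<Pi> \<union> {\<phi>}) (\<phi>s @ [\<phi>]) (Bs @ [{\<phi>}])"
proof -
  let ?\<chi> = "res_seq \<phi>s'"
  have "T \<in> \<T>" and chc: "\<forall>\<phi>\<in>set \<phi>s'. is_chc \<Sigma> T \<phi> \<and> grnd T \<phi> \<subseteq> path E"
    and conj: "\<forall>\<phi>\<in>set \<phi>s'. conjunctive \<phi>"
    using I by (auto simp: adcl_inv_def)
  then have T: "background_theory T" using \<T> by blast
  have \<chi>: "is_chc \<Sigma> T ?\<chi>" "conjunctive ?\<chi>" "grnd T ?\<chi> \<subseteq> path E"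
    using is_chc_res_seq[OF assms(4), of \<Sigma> T] conjunctive_res_seq[OF assms(4) conj assms(5)]
      grnd_res_seq_path[OF T assms(4) chc] chc by simp_all
  have T': "T' \<in> \<T>" "richer T T'" and \<phi>: "is_chc \<Sigma> T' \<phi>" "conjunctive \<phi>"
    and grnd: "grnd T' \<phi> = (\<Union>n\<in>{1..}. grnd T' (res_seq (replicate n ?\<chi>)))"
    using acc[unfolded acceleration_technique_def, rule_format, OF \<open>T \<in> \<T>\<close>, of ?\<chi>] \<chi>(1,2) assms(5,7)
    by simp_all
  have bT': "background_theory T'" using T'(1) \<T> by blast
  have \<chi>': "is_chc \<Sigma> T' ?\<chi>" "grnd T' ?\<chi> \<subseteq> path E"
    using richer_is_chc[OF T'(2) \<chi>(1)] richer_grnd[OF T bT' T'(2) \<chi>(1)] \<chi>(3) by auto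
  have path: "grnd T' \<phi> \<subseteq> path E"
    unfolding grnd using \<chi>' by (intro UN_least grnd_res_seq_path[OF bT', of _ \<Sigma>]) auto
  \<comment> \<open>Composing \<open>m\<close> copies with \<open>n\<close> copies of the resolved
    suffix gives \<open>m + n\<close> copies.\<close>
  have trans: "cmp (grnd T' \<phi>) (grnd T' \<phi>) \<subseteq> grnd T' \<phi>"
  proof (intro subrelI)
    fix x z assume "(x, z) \<in> cmp (grnd T' \<phi>) (grnd T' \<phi>)"
    then obtain m n where mn: "m \<ge> 1" "n \<ge> 1"
      "(x, z) \<in> cmp (grnd T' (res_seq (replicate m ?\<chi>))) (grnd T' (res_seq (replicate n ?\<chi>)))"
      unfolding grnd cmp_def by blast
    moreover have "grnd T' (res_seq (replicate m ?\<chi> @ replicate n ?\<chi>)) =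
      cmp (grnd T' (res_seq (replicate m ?\<chi>))) (grnd T' (res_seq (replicate n ?\<chi>)))"
      using mn(1,2) \<chi>'(1) by (intro grnd_res_seq_append[OF bT']) auto
    ultimately have "(x, z) \<in> grnd T' (res_seq (replicate (m + n) ?\<chi>))" "m + n \<in> {1..}"
      by (simp_all add: replicate_add)
    then show "(x, z) \<in> grnd T' \<phi>" unfolding grnd by blast
  qed
  have "adcl_inv \<Sigma> \<T> \<Phi> E T' (\<Pi> \<union> {\<phi>}) \<phi>s Bs"
    using adcl_inv_richer[OF adcl_inv_append[OF I assms(6)] T bT' T'(2,1) \<phi>(1) path] .
  moreover have "justified T' (\<Pi> \<union> {\<phi>}) E (\<phi>s @ [\<phi>]) \<phi>"
    unfolding justified_def
  proof (intro disjI2 allI impI)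
    fix gs assume d: "derivation T' E ((\<phi>s @ [\<phi>]) @ [\<phi>]) gs"
    then obtain gs'' h where gs'': "gs = gs'' @ [h]"
      using derivation_length[OF d] by (cases gs rule: rev_cases) auto
    then obtain gs' g where gs: "gs = (gs' @ [g]) @ [h]"
      using derivation_length[OF d] by (cases gs'' rule: rev_cases) auto
    have "g \<in> grnd T' \<phi>" "h \<in> grnd T' \<phi>" "approaches E g h" "refutable E (snd h)"
      using d unfolding gs derivation_snoc by auto
    \<comment> \<open>Two consecutive instances of the accelerated clause merge into a single one,
      which ends closer to \<bottom> than \<open>g\<close> and so improves on it.\<close>
    moreover from this have "(fst g, snd h) \<in> cmp (grnd T' \<phi>) (grnd T' \<phi>)"
      unfolding cmp_def approaches_def by (cases g, cases h) auto
    then have "(fst g, snd h) \<in> grnds T' (\<Pi> \<union> {\<phi>})" using trans by (auto simp: grnds_def)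
    ultimately show "improvable (grnds T' (\<Pi> \<union> {\<phi>})) E gs"
      unfolding improvable_def gs approaches_def by auto
  qed
  ultimately show ?thesis using \<phi> path by (intro adcl_inv_step) auto
qed

section \<open>Preservation along the transition relation\<close>

definition adcl_inv_state where
  "adcl_inv_state \<Sigma> \<T> \<Phi> E s \<longleftrightarrow> (case s of
     Problem \<Psi> \<Rightarrow> \<Psi> = \<Phi>
   | State T \<Pi> \<phi>s Bs \<Rightarrow> adcl_inv \<Sigma> \<T> \<Phi> E T \<Pi> \<phi>s Bs
   | Unsat \<Rightarrow> (None, None) \<in> path E
   | Sat \<Rightarrow> (None, None) \<notin> path E)"

lemma adcl_preserves_inv:
  assumes "adcl A accel \<Phi> s s'" and "adcl_inv_state \<Sigma> \<T> \<Phi> (grnds A \<Phi>) s"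
    and "A \<in> \<T>" and \<T>: "\<forall>T\<in>\<T>. background_theory T" and acc: "acceleration_technique \<Sigma> \<T> accel"
    and \<Phi>: "\<forall>\<phi>\<in>\<Phi>. is_chc \<Sigma> A \<phi>"
  shows "adcl_inv_state \<Sigma> \<T> \<Phi> (grnds A \<Phi>) s'"
  using assms(1,2)
proof (cases rule: adcl.cases)
  case Init
  have "grnd A \<phi> \<subseteq> path (grnds A \<Phi>)" if "\<phi> \<in> \<Phi>" for \<phi>
    using that by (auto simp: grnds_def intro: path.edge)
  then show ?thesis using Init assms(3) \<Phi> by (simp add: adcl_inv_state_def adcl_inv_def)
next
  case (Step \<phi> T \<Pi> \<phi>s Bs)
  then have I: "adcl_inv \<Sigma> \<T> \<Phi> (grnds A \<Phi>) T \<Pi> \<phi>s Bs" using assms(2) by (simp add: adcl_inv_state_def)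
  then have chc: "\<forall>\<phi>\<in>\<Pi>. is_chc \<Sigma> T \<phi>" and path: "\<forall>\<phi>\<in>\<Pi>. grnd T \<phi> \<subseteq> path (grnds A \<Phi>)"
    by (simp_all add: adcl_inv_def)
  obtain \<psi> where "\<psi> \<in> \<Pi>" "grnd T \<phi> \<subseteq> grnd T \<psi>" and \<phi>: "is_chc \<Sigma> T \<phi>" "conjunctive \<phi>"
    by (rule sipE[OF \<open>\<phi> \<in> sip T \<Pi>\<close> chc])
  then have "grnd T \<phi> \<subseteq> path (grnds A \<Phi>)" using path by blast
  then show ?thesis using Step I \<phi> by (auto simp: adcl_inv_state_def intro: adcl_inv_step)
next
  case (Accelerate \<phi>s' Bs' T T' \<phi> \<Pi> \<phi>s Bs)
  then show ?thesis
    using adcl_inv_accelerate[OF _ \<T> acc, of \<Phi> _ T \<Pi> \<phi>s \<phi>s' Bs Bs' T' \<phi>] assms(2) by (simp add: adcl_inv_state_def)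
next
  case (Covered \<phi>s' T \<Pi> \<phi>s Bs)
  then have I: "adcl_inv \<Sigma> \<T> \<Phi> (grnds A \<Phi>) T \<Pi> (\<phi>s @ \<phi>s') Bs" using assms(2) by (simp add: adcl_inv_state_def)
  then have T: "background_theory T" using \<T> by (auto simp: adcl_inv_def)
  obtain \<psi>s \<phi> where \<phi>s': "\<phi>s' = \<psi>s @ [\<phi>]" using \<open>\<phi>s' \<noteq> []\<close> by (cases \<phi>s' rule: rev_cases) auto
  have "justified T \<Pi> (grnds A \<Phi>) (\<phi>s @ \<psi>s) \<phi>"
    using justified_covered[OF I[unfolded \<phi>s'] T] Covered(4) by (auto simp: \<phi>s')
  moreover have "adcl_inv \<Sigma> \<T> \<Phi> (grnds A \<Phi>) T \<Pi> ((\<phi>s @ \<psi>s) @ [\<phi>]) Bs" using I by (simp add: \<phi>s')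
  ultimately obtain Bs' where "bt T \<Pi> ((\<phi>s @ \<psi>s) @ [\<phi>]) Bs = State T \<Pi> (\<phi>s @ \<psi>s) Bs'"
    "adcl_inv \<Sigma> \<T> \<Phi> (grnds A \<Phi>) T \<Pi> (\<phi>s @ \<psi>s) Bs'"
    using adcl_inv_bt by blast
  then show ?thesis using Covered(2) by (simp add: adcl_inv_state_def \<phi>s')
next
  case (Backtrack T \<Pi> \<phi>s \<phi> Bs)
  then have I: "adcl_inv \<Sigma> \<T> \<Phi> (grnds A \<Phi>) T \<Pi> (\<phi>s @ [\<phi>]) Bs" using assms(2) by (simp add: adcl_inv_state_def)
  then have T: "background_theory T" using \<T> by (auto simp: adcl_inv_def)
  obtain Bs' where "bt T \<Pi> (\<phi>s @ [\<phi>]) Bs = State T \<Pi> \<phi>s Bs'" "adcl_inv \<Sigma> \<T> \<Phi> (grnds A \<Phi>) T \<Pi> \<phi>s Bs'"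
    using adcl_inv_bt[OF I justified_backtrack[OF I T Backtrack(3-5)]] by blast
  then show ?thesis using Backtrack(2) by (simp add: adcl_inv_state_def)
next
  case (Refute \<phi>s T \<Pi> Bs)
  then have I: "adcl_inv \<Sigma> \<T> \<Phi> (grnds A \<Phi>) T \<Pi> \<phi>s Bs" using assms(2) by (simp add: adcl_inv_state_def)
  then have T: "background_theory T" and chc: "\<forall>\<phi>\<in>set \<phi>s. is_chc \<Sigma> T \<phi> \<and> grnd T \<phi> \<subseteq> path (grnds A \<Phi>)"
    using \<T> by (auto simp: adcl_inv_def)
  then have "grnd T (res_seq \<phi>s) \<subseteq> path (grnds A \<Phi>)"
    by (rule grnd_res_seq_path[OF _ \<open>\<phi>s \<noteq> []\<close>])
  moreover have "(None, None) \<in> grnd T (res_seq \<phi>s)"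
    using Refute by (auto simp: is_refutation_def intro: grnd_conditional_empty)
  ultimately show ?thesis using Refute by (auto simp: adcl_inv_state_def)
next
  case (Prove T \<Pi> B)
  let ?E = "grnds A \<Phi>"
  have I: "adcl_inv \<Sigma> \<T> \<Phi> ?E T \<Pi> [] [B]" using assms(2) Prove by (simp add: adcl_inv_state_def)
  then have "\<Phi> \<subseteq> \<Pi>" by (simp add: adcl_inv_def)
  then have "grnds T \<Phi> \<subseteq> grnds T \<Pi>" unfolding grnds_def by blast
  then have "?E \<subseteq> grnds T \<Pi>" using I by (simp add: adcl_inv_def)
  have "(None, None) \<notin> path ?E"
  proof
    assume "(None, None) \<in> path ?E"
    moreover have "refutable ?E None" unfolding refutable_def by (blast intro: refutes.intros)
    ultimately obtain z0 where z0: "(None, z0) \<in> ?E" "refutable ?E z0"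
      using path_refutable by blast
    have "redundant T \<pi> B" if \<pi>: "\<pi> \<in> sip T \<Pi>" "(None, z) \<in> grnd T \<pi>" for \<pi> z
    proof -
      have "body \<pi> = None" using \<pi>(2) by (cases "body \<pi>") (auto simp: grnd_def)
      then have "\<not> active T [] [B] \<pi>"
        using Prove \<pi>(1) by (auto simp: is_fact_def is_conditional_empty_def)
      then show ?thesis using \<pi>(2) unfolding active_def grnd_nonempty_iff[symmetric] by auto
    qed
    \<comment> \<open>As all continuations of the empty derivation are blocked, one of its steps
      could be improved; but it has no steps.\<close>
    then have "improvable (grnds T \<Pi>) ?E []"
      using z0 \<open>?E \<subseteq> grnds T \<Pi>\<close> adcl_inv_last[OF I] adcl_inv_last_finite[OF I]
      by (intro improvable_of_blocked[of B T \<Pi> ?E "[]" None z0]) (auto simp: derivation_def)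
    then show False by (simp add: improvable_def)
  qed
  then show ?thesis using Prove by (simp add: adcl_inv_state_def)
qed

text \<open>In any model truth propagates along paths, so a path from \<top> to \<bottom> excludes
  models. If there is no such path, the atoms reachable from \<top> form a model.\<close>

lemma satisfiable_iff:
  assumes "\<forall>\<phi>\<in>\<Phi>. is_chc \<Sigma> T \<phi>"
  shows "satisfiable T \<Phi> \<longleftrightarrow> (None, None) \<notin> path (grnds T \<Phi>)"
proof
  assume "satisfiable T \<Phi>"
  then obtain I where "\<forall>\<phi>\<in>\<Phi>. sat_chc T I \<phi>" by (auto simp: satisfiable_def)
  then have I: "holds I True x \<Longrightarrow> holds I False y" if "(x, y) \<in> grnds T \<Phi>" for x y
    using that assms by (fastforce simp: grnds_def sat_chc_iff)
  have "(x, y) \<in> path (grnds T \<Phi>) \<Longrightarrow> holds I True x \<Longrightarrow> holds I False y" for x y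
    by (induction "(x, y)" arbitrary: y rule: path.induct) (use I in fastforce)+
  from this[of None None] show "(None, None) \<notin> path (grnds T \<Phi>)" by auto
next
  assume unsat: "(None, None) \<notin> path (grnds T \<Phi>)"
  define I where "I F ts \<longleftrightarrow> (None, Some (Atom F ts)) \<in> path (grnds T \<Phi>)" for F ts
  have "holds I False y" if "(x, y) \<in> grnds T \<Phi>" "holds I True x" for x y
    using that unsat
    by (cases x; cases y) (auto simp: I_def intro: path.intros)
  then have "\<forall>\<phi>\<in>\<Phi>. sat_chc T I \<phi>" using assms by (fastforce simp: grnds_def sat_chc_iff)
  then show "satisfiable T \<Phi>" by (auto simp: satisfiable_def)
qed

theorem theorem12:
  fixes \<Sigma> :: "('p, 's :: countable) psym set"
    and A :: "('f, 'q, 's) background"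
    and \<T> :: "('f, 'q, 's) background set"
    and accel :: "('f, 'q, 's) background \<Rightarrow> ('p, 'f, 'q, 's) chc \<Rightarrow>
      ('f, 'q, 's) background \<times> ('p, 'f, 'q, 's) chc"
    and \<Phi> :: "('p, 'f, 'q, 's) chc set"
  assumes "A \<in> \<T>"
    and "\<forall>T\<in>\<T>. background_theory T"
    and "acceleration_technique \<Sigma> \<T> accel"
    and "\<forall>\<phi>\<in>\<Phi>. is_chc \<Sigma> A \<phi>"
  shows "((adcl A accel \<Phi>)\<^sup>*\<^sup>* (Problem \<Phi>) Sat \<longrightarrow> satisfiable A \<Phi>) \<and>
         ((adcl A accel \<Phi>)\<^sup>*\<^sup>* (Problem \<Phi>) Unsat \<longrightarrow> \<not> satisfiable A \<Phi>)"
proof -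
  have "(adcl A accel \<Phi>)\<^sup>*\<^sup>* (Problem \<Phi>) s \<Longrightarrow> adcl_inv_state \<Sigma> \<T> \<Phi> (grnds A \<Phi>) s" for s
  proof (induction rule: rtranclp_induct)
    case base
    then show ?case by (simp add: adcl_inv_state_def)
  next
    case (step s s')
    then show ?case using adcl_preserves_inv assms by blast
  qed
  from this[of Sat] this[of Unsat] show ?thesis
    using satisfiable_iff[OF assms(4)] by (simp add: adcl_inv_state_def)
qed

end
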